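(* Let $\mathcal{N}\colon A\to B'$ and $\mathcal{M}\colon A\to B$ be quantum channels, let $\sigma_{RA}$ be a quantum state, and let $\eta\geq 0$. Then the following are equivalent: (i) For all classical-quantum states $\rho_{RUA}=\sum_u p(u)|u\rangle\langle u|_U\otimes\rho^u_{RA}$ with marginal $\rho_{RA}=\sigma_{RA}$, where $U$ is a classical system of size $|U|=2$ and $\rho^0_R=\rho^1_R$, $$\eta\, I(U:BR)\geq I(U:B'R).$$ (ii) For all classical-quantum states $\rho_{RUA}=\sum_u p(u)|u\rangle\langle u|_U\otimes\rho^u_{RA}$ with marginal $\rho_{RA}=\sigma_{RA}$, where $U$ is an arbitrary classical system and $\rho^u_R=\rho^v_R$ for all $u,v$, $$\eta\, I(U:BR)\geq I(U:B'R).$$ (iii) For all quantum states $\rho_{RA}$ with $\operatorname{supp}(\rho_{RA})\subseteq\operatorname{supp}(\sigma_{RA})$ and $\rho_R=\sigma_R$, $$\eta\, D(\mathcal{M}(\rho_{RA})\|\mathcal{M}(\sigma_{RA}))\geq D(\mathcal{N}(\rho_{RA})\|\mathcal{N}(\sigma_{RA})).$$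
   Context: All systems are finite-dimensional. A channel on $A$ acts as the identity on other systems. $D(\rho\|\sigma)=\operatorname{Tr}[\rho(\log\rho-\log\sigma)]$ if $\operatorname{supp}(\rho)\subseteq\operatorname{supp}(\sigma)$, else $+\infty$; $I(A:B)=D(\rho_{AB}\|\rho_A\otimes\rho_B)$. In (i) and (ii), $I(U:BR)$ is evaluated on $\mathcal{M}(\rho_{RUA})$ and $I(U:B'R)$ on $\mathcal{N}(\rho_{RUA})$; $(|u\rangle)_u$ is an orthonormal basis, $p$ a probability distribution, and $\rho^u_{RA}$ are states. *)

theory Defs
  imports
    "Jordan_Normal_Form.Schur_Decomposition"
    "Jordan_Normal_Form.Matrix_Kernel"
    "HOL-Library.Extended_Real"
begin

text \<open>
  A finite-dimensional system is identified with \<open>C^d\<close>, and operators on it with complex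
  \<open>d \<times> d\<close> matrices. The composite of systems of dimensions \<open>m\<close> and \<open>n\<close> (in this order) is
  \<open>C^(m * n)\<close>, where the product basis vector with labels \<open>(i, j)\<close> has index \<open>i * n + j\<close>.
  Composites of three systems are therefore independent of the bracketing.
\<close>

definition psd :: "nat \<Rightarrow> complex mat \<Rightarrow> bool" where
  "psd n A \<longleftrightarrow> A \<in> carrier_mat n n \<and> (\<forall>v \<in> carrier_vec n. 0 \<le> (A *\<^sub>v v) \<bullet>c v)"
  \<comment> \<open>In the order on complex numbers, \<open>0 \<le> z\<close> includes that \<open>z\<close> is real; so \<open>A\<close> is Hermitian.\<close>

definition mtrace :: "complex mat \<Rightarrow> complex" where
  "mtrace A = (\<Sum>i<dim_row A. A $$ (i, i))"

definition density_operator :: "nat \<Rightarrow> complex mat \<Rightarrow> bool" where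
  "density_operator n \<rho> \<longleftrightarrow> psd n \<rho> \<and> mtrace \<rho> = 1"

definition tensor_mat :: "complex mat \<Rightarrow> complex mat \<Rightarrow> complex mat" where
  "tensor_mat A B = mat (dim_row A * dim_row B) (dim_col A * dim_col B)
     (\<lambda>(i, j). A $$ (i div dim_row B, j div dim_col B) * B $$ (i mod dim_row B, j mod dim_col B))"

definition ketbra :: "complex vec \<Rightarrow> complex vec \<Rightarrow> complex mat" where
  "ketbra v w = mat (dim_vec v) (dim_vec w) (\<lambda>(i, j). v $ i * cnj (w $ j))"

definition ptrace_fst :: "nat \<Rightarrow> nat \<Rightarrow> complex mat \<Rightarrow> complex mat" where
  "ptrace_fst m n X = mat n n (\<lambda>(i, j). \<Sum>k<m. X $$ (k * n + i, k * n + j))"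

definition ptrace_snd :: "nat \<Rightarrow> nat \<Rightarrow> complex mat \<Rightarrow> complex mat" where
  "ptrace_snd m n X = mat m m (\<lambda>(i, j). \<Sum>k<n. X $$ (i * n + k, j * n + k))"

text \<open>
  For a linear map \<open>N\<close> from \<open>a \<times> a\<close> to \<open>b \<times> b\<close> matrices, \<open>ampliation k a b N\<close> is the map
  \<open>id \<otimes> N\<close> with the identity on \<open>k \<times> k\<close> matrices: it applies \<open>N\<close> to each of the
  \<open>a \<times> a\<close> blocks of its argument.
\<close>

definition ampliation ::
  "nat \<Rightarrow> nat \<Rightarrow> nat \<Rightarrow> (complex mat \<Rightarrow> complex mat) \<Rightarrow> complex mat \<Rightarrow> complex mat" where
  "ampliation k a b N X = mat (k * b) (k * b)
     (\<lambda>(i, j). N (mat a a (\<lambda>(r, s). X $$ ((i div b) * a + r, (j div b) * a + s)))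
                 $$ (i mod b, j mod b))"

definition quantum_channel :: "nat \<Rightarrow> nat \<Rightarrow> (complex mat \<Rightarrow> complex mat) \<Rightarrow> bool" where
  "quantum_channel a b N \<longleftrightarrow>
     (\<forall>X \<in> carrier_mat a a. N X \<in> carrier_mat b b) \<and>
     (\<forall>X \<in> carrier_mat a a. \<forall>Y \<in> carrier_mat a a. N (X + Y) = N X + N Y) \<and>
     (\<forall>c. \<forall>X \<in> carrier_mat a a. N (c \<cdot>\<^sub>m X) = c \<cdot>\<^sub>m N X) \<and>
     (\<forall>k X. psd (k * a) X \<longrightarrow> psd (k * b) (ampliation k a b N X)) \<and>
     (\<forall>X \<in> carrier_mat a a. mtrace (N X) = mtrace X)"

definition unitary_mat :: "nat \<Rightarrow> complex mat \<Rightarrow> bool" where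
  "unitary_mat n U \<longleftrightarrow> U \<in> carrier_mat n n \<and> mat_adjoint U * U = 1\<^sub>m n"

text \<open>
  Functional calculus for Hermitian matrices: the result does not depend on the choice of the
  spectral decomposition.
\<close>

definition mat_fun :: "(real \<Rightarrow> real) \<Rightarrow> complex mat \<Rightarrow> complex mat" where
  "mat_fun f A = (THE B. \<exists>U d. unitary_mat (dim_row A) U \<and>
     A = U * mat_diag (dim_row A) (\<lambda>i. complex_of_real (d i)) * mat_adjoint U \<and>
     B = U * mat_diag (dim_row A) (\<lambda>i. complex_of_real (f (d i))) * mat_adjoint U)"

text \<open>
  The logarithm of a positive semidefinite matrix is taken on its support and is zero on its
  kernel, in accordance with \<open>0 log 0 = 0\<close>.
\<close>

definition mat_log :: "complex mat \<Rightarrow> complex mat" where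
  "mat_log A = mat_fun (\<lambda>x. if x = 0 then 0 else ln x) A"

definition supp :: "complex mat \<Rightarrow> complex vec set" where
  "supp A = {v \<in> carrier_vec (dim_col A). \<forall>w \<in> mat_kernel A. v \<bullet>c w = 0}"

definition relative_entropy :: "complex mat \<Rightarrow> complex mat \<Rightarrow> ereal" where
  "relative_entropy \<rho> \<sigma> =
     (if supp \<rho> \<subseteq> supp \<sigma> then ereal (Re (mtrace (\<rho> * (mat_log \<rho> - mat_log \<sigma>)))) else \<infinity>)"

definition mutual_information :: "nat \<Rightarrow> nat \<Rightarrow> complex mat \<Rightarrow> ereal" where
  "mutual_information m n \<rho> =
     relative_entropy \<rho> (tensor_mat (ptrace_snd m n \<rho>) (ptrace_fst m n \<rho>))"

definition orthonormal_basis :: "nat \<Rightarrow> (nat \<Rightarrow> complex vec) \<Rightarrow> bool" where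
  "orthonormal_basis n e \<longleftrightarrow>
     (\<forall>u<n. e u \<in> carrier_vec n) \<and>
     (\<forall>u<n. \<forall>v<n. e u \<bullet>c e v = (if u = v then 1 else 0))"

definition prob_dist :: "nat \<Rightarrow> (nat \<Rightarrow> real) \<Rightarrow> bool" where
  "prob_dist n p \<longleftrightarrow> (\<forall>u<n. 0 \<le> p u) \<and> (\<Sum>u<n. p u) = 1"

text \<open>
  \<open>cq_ensemble n d e p \<rho>s\<close> says that \<open>e\<close>, \<open>p\<close>, \<open>\<rho>s\<close> are data defining a classical-quantum state
  with classical system of size \<open>n\<close> and quantum system of dimension \<open>d\<close>; \<open>cq_state\<close> is that
  state, the sum over \<open>u\<close> of \<open>p(u) |u\<rangle>\<langle>u| \<otimes> \<rho>s u\<close>, with the classical system as the first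
  factor.
\<close>

definition cq_ensemble ::
  "nat \<Rightarrow> nat \<Rightarrow> (nat \<Rightarrow> complex vec) \<Rightarrow> (nat \<Rightarrow> real) \<Rightarrow> (nat \<Rightarrow> complex mat) \<Rightarrow> bool" where
  "cq_ensemble n d e p \<rho>s \<longleftrightarrow>
     orthonormal_basis n e \<and> prob_dist n p \<and> (\<forall>u<n. density_operator d (\<rho>s u))"

definition cq_state ::
  "nat \<Rightarrow> nat \<Rightarrow> (nat \<Rightarrow> complex vec) \<Rightarrow> (nat \<Rightarrow> real) \<Rightarrow> (nat \<Rightarrow> complex mat) \<Rightarrow> complex mat" where
  "cq_state n d e p \<rho>s = mat (n * d) (n * d)
     (\<lambda>ij. \<Sum>u<n. (complex_of_real (p u) \<cdot>\<^sub>m tensor_mat (ketbra (e u) (e u)) (\<rho>s u)) $$ ij)"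

end

theory Submission
  imports Defs
begin

text \<open>
  On a classical-quantum state the mutual information is the average
  \<open>\<Sum>u. p u * D (\<rho> u \<parallel> \<sigma>)\<close> of the relative entropies to the marginal \<open>\<sigma>\<close>, and this form is
  preserved by a channel. Hence (iii) implies (ii) termwise: every \<open>\<rho> u\<close> with \<open>p u > 0\<close> is
  dominated by a multiple of \<open>\<sigma>\<close>. For (i) implies (iii), perturb \<open>\<sigma>\<close> away from \<open>\<rho>\<close>:
  \<open>\<tau> = \<sigma> + \<mu> (\<sigma> - \<rho>)\<close> is a state for small \<open>\<mu>\<close>, and \<open>\<sigma>\<close> is the mixture of \<open>\<rho>\<close> and \<open>\<tau>\<close> with
  weights \<open>\<mu> / (1 + \<mu>)\<close> and \<open>1 / (1 + \<mu>)\<close>. The bound \<open>D \<le> Tr (\<tau>\<^sup>2 \<sigma>') - 1\<close>, with \<open>\<sigma>'\<close>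
  the inverse of \<open>\<sigma>\<close> on its support, applied after the channel, makes the contribution of \<open>\<tau>\<close> of order \<open>\<mu>\<^sup>2\<close>, so dividing by \<open>\<mu>\<close> and letting
  \<open>\<mu> \<rightarrow> 0\<close> leaves the inequality for \<open>\<rho>\<close>.

  All entropic quantities are computed from spectral decompositions: with
  \<open>P i j = |\<langle>e i, f j\<rangle>|\<^sup>2\<close> for eigenbases \<open>e\<close>, \<open>f\<close> and eigenvalues \<open>r\<close>, \<open>s\<close>, the relative entropy
  is \<open>\<Sum>i j. P i j * r i * ln (r i / s j)\<close>, which reduces Klein's inequality and the quadratic
  bound to inequalities between real numbers.
\<close>

section \<open>Spectral theorem and functional calculus\<close>

lemma mtrace_mult_comm:
  assumes "A \<in> carrier_mat n m" "B \<in> carrier_mat m n"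
  shows "mtrace (A * B) = mtrace (B * A)"
proof -
  have "mtrace (A * B) = (\<Sum>i<n. \<Sum>j<m. A $$ (i, j) * B $$ (j, i))"
    using assms by (auto simp: mtrace_def scalar_prod_def atLeast0LessThan)
  also have "\<dots> = (\<Sum>j<m. \<Sum>i<n. B $$ (j, i) * A $$ (i, j))"
    by (subst sum.swap) (simp add: mult.commute)
  also have "\<dots> = mtrace (B * A)"
    using assms by (auto simp: mtrace_def scalar_prod_def atLeast0LessThan)
  finally show ?thesis .
qed

text \<open>Schur triangularization gives a similar matrix with the roots on its diagonal, and
  similarity preserves the trace by \<open>mtrace_mult_comm\<close>.\<close>

lemma mtrace_eq_sum_list_char_poly_roots:
  assumes A: "A \<in> carrier_mat n n" and cp: "char_poly A = (\<Prod>a\<leftarrow>as. [:- a, 1:])"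
  shows "mtrace A = sum_list as"
proof -
  obtain B P Q where "schur_decomposition A as = (B, P, Q)"
    by (cases "schur_decomposition A as") auto
  from schur_decomposition[OF A cp this]
  have sim: "similar_mat_wit A B P Q" and diag: "diag_mat B = as"
    by auto
  from similar_mat_witD2[OF A sim]
  have "Q * P = 1\<^sub>m n" "A = P * B * Q" and carr: "B \<in> carrier_mat n n" "P \<in> carrier_mat n n" "Q \<in> carrier_mat n n"
    by auto
  then have "mtrace A = mtrace (Q * (P * B))"
    using mtrace_mult_comm[of "P * B" n n Q] by simp
  also have "Q * (P * B) = B"
    using carr \<open>Q * P = 1\<^sub>m n\<close> by (simp flip: assoc_mult_mat)
  also have "mtrace B = sum_list as"
    unfolding diag[symmetric] diag_mat_def mtrace_def
    by (simp add: sum_list_sum_nth atLeast0LessThan)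
  finally show ?thesis .
qed

text \<open>If \<open>c\<close> were the only eigenvalue, all \<open>n\<close> roots of the
  characteristic polynomial would be \<open>c\<close>, and the trace would be
  \<open>n * c\<close>.\<close>

lemma ex_eigenvalue_neq:
  fixes A :: "complex mat"
  assumes A: "A \<in> carrier_mat n n" and tr: "mtrace A \<noteq> of_nat n * c"
  shows "\<exists>k. k \<noteq> c \<and> eigenvalue A k"
proof (rule ccontr)
  assume *: "\<not> ?thesis"
  obtain as where as: "char_poly A = (\<Prod>a\<leftarrow>as. [:- a, 1:])" "length as = n"
    using char_poly_factorized[OF A] by auto
  have "eigenvalue A a" if "a \<in> set as" for a
    using that eigenvalue_root_char_poly[OF A] as(1) by (simp add: poly_prod_list prod_list_zero_iff)
  then have "as = replicate n c"
    using * as(2) by (auto intro!: replicate_eqI)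
  then have "sum_list as = of_nat n * c"
    by (simp add: sum_list_replicate)
  then show False
    using mtrace_eq_sum_list_char_poly_roots[OF A as(1)] tr by simp
qed

section \<open>Coordinate vectors and eigenvectors of Hermitian matrices\<close>

definition hermitian :: "nat \<Rightarrow> complex mat \<Rightarrow> bool" where
  "hermitian n A \<longleftrightarrow> A \<in> carrier_mat n n \<and> (\<forall>a<n. \<forall>b<n. A $$ (b, a) = cnj (A $$ (a, b)))"

text \<open>Vectors are functions of which only the values below \<open>n\<close> count, so linear
  combinations are plain lambda terms without carrier conditions.\<close>

definition inner :: "nat \<Rightarrow> (nat \<Rightarrow> complex) \<Rightarrow> (nat \<Rightarrow> complex) \<Rightarrow> complex" where
  "inner n v w = (\<Sum>a<n. v a * cnj (w a))"

definition app :: "nat \<Rightarrow> complex mat \<Rightarrow> (nat \<Rightarrow> complex) \<Rightarrow> nat \<Rightarrow> complex" where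
  "app n A v a = (\<Sum>b<n. A $$ (a, b) * v b)"

definition orthonormal :: "nat \<Rightarrow> nat \<Rightarrow> (nat \<Rightarrow> nat \<Rightarrow> complex) \<Rightarrow> bool" where
  "orthonormal k n e \<longleftrightarrow> (\<forall>i<k. \<forall>j<k. inner n (e i) (e j) = (if i = j then 1 else 0))"

text \<open>\<open>e k a\<close> is coordinate \<open>a\<close> of the \<open>k\<close>-th eigenvector.\<close>

definition spectral :: "nat \<Rightarrow> complex mat \<Rightarrow> (nat \<Rightarrow> nat \<Rightarrow> complex) \<Rightarrow> (nat \<Rightarrow> real) \<Rightarrow> bool" where
  "spectral n A e d \<longleftrightarrow> A \<in> carrier_mat n n \<and> orthonormal n n e \<and>
     (\<forall>a<n. \<forall>b<n. A $$ (a, b) = (\<Sum>k<n. d k * e k a * cnj (e k b)))"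

lemma inner_commute: "inner n w v = cnj (inner n v w)"
  by (simp add: inner_def cnj_sum mult.commute)

lemma inner_self: "inner n v v = (\<Sum>a<n. (cmod (v a))\<^sup>2)"
  by (simp only: inner_def of_real_sum complex_norm_square)

lemma inner_cong: "(\<And>a. a < n \<Longrightarrow> v a = v' a) \<Longrightarrow> (\<And>a. a < n \<Longrightarrow> w a = w' a) \<Longrightarrow> inner n v w = inner n v' w'"
  by (simp add: inner_def)

lemma inner_add_left: "inner n (\<lambda>a. v a + w a) x = inner n v x + inner n w x"
  by (simp add: inner_def sum.distrib ring_distribs)

lemma inner_scale_left: "inner n (\<lambda>a. c * v a) x = c * inner n v x"
  by (simp add: inner_def sum_distrib_left mult.assoc)

lemma inner_scale_right: "inner n x (\<lambda>a. c * v a) = cnj c * inner n x v"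
  by (simp add: inner_def sum_distrib_left ac_simps)

lemma inner_sum_left: "inner n (\<lambda>a. \<Sum>i\<in>I. v i a) x = (\<Sum>i\<in>I. inner n (v i) x)"
  unfolding inner_def sum_distrib_right by (rule sum.swap)

lemma inner_app_hermitian:
  assumes "hermitian n A"
  shows "inner n (app n A v) w = inner n v (app n A w)"
proof -
  have *: "cnj (A $$ (b, a)) = A $$ (a, b)" if "a < n" "b < n" for a b
    using assms that unfolding hermitian_def by (metis complex_cnj_cnj)
  have "inner n v (app n A w) = (\<Sum>b<n. \<Sum>a<n. v b * (cnj (A $$ (b, a)) * cnj (w a)))"
    by (simp add: inner_def app_def cnj_sum sum_distrib_left)
  also have "\<dots> = (\<Sum>a<n. \<Sum>b<n. A $$ (a, b) * v b * cnj (w a))"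
    by (subst sum.swap) (simp add: * mult_ac)
  finally show ?thesis
    by (simp add: inner_def app_def sum_distrib_right)
qed

lemma eigenvalueE:
  assumes A: "A \<in> carrier_mat n n" and ev: "eigenvalue A x"
  obtains w where "\<exists>a<n. w a \<noteq> 0" "\<And>a. a < n \<Longrightarrow> app n A w a = x * w a"
proof -
  obtain v where v: "v \<in> carrier_vec n" "v \<noteq> 0\<^sub>v n" "A *\<^sub>v v = x \<cdot>\<^sub>v v"
    using ev A by (auto simp: eigenvalue_def eigenvector_def)
  have "\<exists>a<n. v $ a \<noteq> 0"
    using v(1,2) by (metis carrier_vecD dim_vec eq_vecI index_zero_vec(1) index_zero_vec(2))
  moreover have "app n A (($) v) a = x * v $ a" if "a < n" for a
    using arg_cong[OF v(3), of "\<lambda>u. u $ a"] that v(1) A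
    by (simp add: app_def scalar_prod_def atLeast0LessThan)
  ultimately show ?thesis
    using that by blast
qed

lemma hermitian_extend_eigenvectors:
  fixes d :: "nat \<Rightarrow> real" and e :: "nat \<Rightarrow> nat \<Rightarrow> complex"
  assumes A: "hermitian n A" and k: "k < n" and e: "orthonormal k n e"
    and d: "\<And>i a. i < k \<Longrightarrow> a < n \<Longrightarrow> app n A (e i) a = d i * e i a"
  shows "\<exists>w x. inner n w w = 1 \<and> (\<forall>i<k. inner n w (e i) = 0) \<and> (\<forall>a<n. app n A w a = complex_of_real x * w a)"
proof -
  have Ac: "A \<in> carrier_mat n n"
    using A by (simp add: hermitian_def)
  \<comment> \<open>\<open>B\<close> has the non-real eigenvalue \<open>\<i>\<close> on the given eigenvectors and agrees with \<open>A\<close> on their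
    orthogonal complement; since its trace has imaginary part \<open>k < n\<close>, it has another eigenvalue,
    whose eigenvector is orthogonal to the given ones.\<close>
  define B where "B = mat n n (\<lambda>(a, b). A $$ (a, b) + (\<Sum>i<k. (\<i> - d i) * e i a * cnj (e i b)))"
  have "mtrace B = mtrace A + (\<Sum>i<k. (\<i> - d i) * inner n (e i) (e i))"
    using Ac unfolding mtrace_def B_def inner_def sum_distrib_left
    by (simp add: sum.distrib mult.assoc sum.swap[of _ "{..<n}" "{..<k}"])
  also have "(\<Sum>i<k. (\<i> - d i) * inner n (e i) (e i)) = (\<Sum>i<k. \<i> - d i)"
    using e by (simp add: orthonormal_def)
  finally have trB: "mtrace B = mtrace A + (\<Sum>i<k. \<i> - d i)" .
  have "Im (A $$ (a, a)) = 0" if "a < n" for a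
    using A that unfolding hermitian_def by (metis Reals_cnj_iff complex_is_Real_iff)
  then have "Im (mtrace A) = 0"
    using Ac by (simp add: mtrace_def)
  then have "Im (mtrace B) \<noteq> Im (of_nat n * \<i>)"
    using k by (simp add: trB)
  then have "mtrace B \<noteq> of_nat n * \<i>"
    by metis
  moreover have Bc: "B \<in> carrier_mat n n"
    by (simp add: B_def)
  ultimately obtain x where x: "x \<noteq> \<i>" "eigenvalue B x"
    using ex_eigenvalue_neq by blast
  obtain w where w0: "\<exists>a<n. w a \<noteq> 0" and w: "\<And>a. a < n \<Longrightarrow> app n B w a = x * w a"
    using eigenvalueE[OF Bc x(2)] by blast
  have appB: "app n B w a = app n A w a + (\<Sum>i<k. (\<i> - d i) * inner n w (e i) * e i a)" if "a < n" for a
  proof -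
    have "app n B w a = app n A w a + (\<Sum>b<n. \<Sum>i<k. (\<i> - d i) * e i a * cnj (e i b) * w b)"
      using that by (simp add: app_def B_def sum.distrib ring_distribs sum_distrib_right)
    also have "(\<Sum>b<n. \<Sum>i<k. (\<i> - d i) * e i a * cnj (e i b) * w b) =
        (\<Sum>i<k. (\<i> - d i) * inner n w (e i) * e i a)"
      by (subst sum.swap, rule sum.cong) (simp_all add: inner_def sum_distrib_right sum_distrib_left mult_ac)
    finally show ?thesis .
  qed
  \<comment> \<open>Pair the eigenvalue equation of \<open>B\<close> with \<open>e j\<close>: the
    \<open>A\<close> part contributes \<open>d j\<close> and the added part
    \<open>\<i> - d j\<close>, in total \<open>\<i>\<close>. As \<open>x \<noteq> \<i>\<close>, the
    overlap vanishes.\<close>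
  have orth: "inner n w (e j) = 0" if j: "j < k" for j
  proof -
    have "x * inner n w (e j) = inner n (app n B w) (e j)"
      using w by (simp add: inner_scale_left cong: inner_cong)
    also have "\<dots> = inner n (app n A w) (e j) + (\<Sum>i<k. (\<i> - d i) * inner n w (e i) * inner n (e i) (e j))"
      by (simp add: inner_add_left inner_sum_left inner_scale_left appB cong: inner_cong)
    also have "inner n (app n A w) (e j) = d j * inner n w (e j)"
      using d[OF j] by (simp add: inner_app_hermitian[OF A] inner_scale_right cong: inner_cong)
    also have "(\<Sum>i<k. (\<i> - d i) * inner n w (e i) * inner n (e i) (e j)) = (\<i> - d j) * inner n w (e j)"
      by (subst sum.remove[of _ j]) (use e j in \<open>auto simp: orthonormal_def intro!: sum.neutral\<close>)
    finally have "(x - \<i>) * inner n w (e j) = 0"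
      by (simp add: left_diff_distrib)
    then show ?thesis
      using x(1) by simp
  qed
  have Aw: "app n A w a = x * w a" if "a < n" for a
    using w[OF that] appB[OF that] orth by simp
  define N where "N = (\<Sum>a<n. (cmod (w a))\<^sup>2)"
  have N: "N > 0"
    unfolding N_def using w0 by (auto intro!: sum_pos2)
  have ww: "inner n w w = complex_of_real N"
    by (simp add: N_def inner_self)
  \<comment> \<open>By \<open>Aw\<close>, \<open>x\<close> is an eigenvalue of the Hermitian
    \<open>A\<close> itself; moving \<open>A\<close> across the inner product shows that it is
    real.\<close>
  have "x * N = inner n (app n A w) w"
    using Aw by (simp add: inner_scale_left ww cong: inner_cong)
  also have "\<dots> = cnj x * N"
    unfolding inner_app_hermitian[OF A] using Aw by (simp add: inner_scale_right ww cong: inner_cong)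
  finally have "x = cnj x"
    using N by simp
  then obtain x' where x': "x = complex_of_real x'"
    by (metis Reals_cnj_iff Reals_cases)
  define c where "c = complex_of_real (1 / sqrt N)"
  define w' where "w' a = c * w a" for a
  have "c * cnj c * N = complex_of_real (1 / sqrt N * (1 / sqrt N) * N)"
    unfolding c_def complex_cnj_complex_of_real of_real_mult ..
  also have "1 / sqrt N * (1 / sqrt N) * N = 1"
    using N by simp
  finally have "inner n w' w' = 1"
    unfolding w'_def inner_scale_left inner_scale_right ww by (simp only: mult.assoc of_real_1)
  moreover have "app n A w' a = complex_of_real x' * w' a" if "a < n" for a
  proof -
    have "app n A w' a = c * app n A w a"
      unfolding app_def w'_def sum_distrib_left by (rule sum.cong) simp_all
    then show ?thesis
      using Aw[OF that] x' by (simp add: w'_def)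
  qed
  moreover have "inner n w' (e i) = 0" if "i < k" for i
    unfolding w'_def inner_scale_left using orth[OF that] by simp
  ultimately show ?thesis
    by blast
qed

lemma hermitian_eigenvectors:
  assumes A: "hermitian n A"
  shows "k \<le> n \<Longrightarrow> \<exists>e d. orthonormal k n e \<and> (\<forall>i<k. \<forall>a<n. app n A (e i) a = complex_of_real (d i) * e i a)"
proof (induction k)
  case 0
  then show ?case by (simp add: orthonormal_def)
next
  case (Suc k)
  then obtain e d where e: "orthonormal k n e" "\<And>i a. i < k \<Longrightarrow> a < n \<Longrightarrow> app n A (e i) a = complex_of_real (d i) * e i a"
    by auto
  then obtain w x where w: "inner n w w = 1" "\<And>i. i < k \<Longrightarrow> inner n w (e i) = 0"
    "\<And>a. a < n \<Longrightarrow> app n A w a = complex_of_real x * w a"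
    using hermitian_extend_eigenvectors[OF A _ e] Suc.prems by (auto simp: Suc_le_eq)
  moreover have "inner n (e i) w = 0" if "i < k" for i
    using w(2)[OF that] inner_commute[of n "e i" w] by simp
  ultimately have "orthonormal (Suc k) n (e(k := w))"
    using e by (auto simp: orthonormal_def less_Suc_eq)
  then show ?case
    using e w by (intro exI[of _ "e(k := w)"] exI[of _ "d(k := x)"] conjI) (assumption, auto simp: less_Suc_eq)
qed

text \<open>Orthonormality makes \<open>F\<close> a right inverse of the square matrix
  \<open>E\<close>, hence also a left inverse, which is the completeness relation.\<close>

lemma orthonormal_complete:
  assumes e: "orthonormal n n e" and "a < n" "b < n"
  shows "(\<Sum>k<n. e k a * cnj (e k b)) = (if a = b then 1 else 0)"
proof -
  define E where "E = mat n n (\<lambda>(k, a). e k a)"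
  define F where "F = mat n n (\<lambda>(a, k). cnj (e k a))"
  have "E * F = 1\<^sub>m n"
    using e by (auto simp: E_def F_def scalar_prod_def atLeast0LessThan orthonormal_def inner_def)
  then have "F * E = 1\<^sub>m n"
    by (intro mat_mult_left_right_inverse[of E]) (auto simp: E_def F_def)
  then have "(F * E) $$ (b, a) = (if a = b then 1 else 0)"
    using assms by simp
  then show ?thesis
    using assms by (simp add: E_def F_def scalar_prod_def atLeast0LessThan mult.commute)
qed

section \<open>Expansions in eigenbases and the spectral theorem\<close>

lemma inner_app_eq: "inner n (app n A v) w = (\<Sum>a<n. \<Sum>b<n. A $$ (a, b) * v b * cnj (w a))"
  by (simp add: inner_def app_def sum_distrib_right)

lemma inner_diff_left: "inner n (\<lambda>a. v a - w a) x = inner n v x - inner n w x"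
  by (simp add: inner_def sum_subtractf left_diff_distrib)

lemma app_diff:
  assumes "A \<in> carrier_mat n n" "B \<in> carrier_mat n n" "a < n"
  shows "app n (A - B) v a = app n A v a - app n B v a"
  using assms by (simp add: app_def sum_subtractf left_diff_distrib)

lemma spectral_carrier: "spectral n A e d \<Longrightarrow> A \<in> carrier_mat n n"
  by (simp add: spectral_def)

lemma spectral_orthonormal: "spectral n A e d \<Longrightarrow> orthonormal n n e"
  by (simp add: spectral_def)

lemma orthonormal_inner: "orthonormal n n e \<Longrightarrow> i < n \<Longrightarrow> j < n \<Longrightarrow> inner n (e i) (e j) = (if i = j then 1 else 0)"
  by (simp add: orthonormal_def)

lemma orthonormal_expand:
  assumes "orthonormal n n e" "a < n"
  shows "(\<Sum>k<n. inner n v (e k) * e k a) = v a"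
proof -
  have "(\<Sum>k<n. inner n v (e k) * e k a) = (\<Sum>k<n. \<Sum>b<n. v b * (e k a * cnj (e k b)))"
    by (simp add: inner_def sum_distrib_left mult_ac)
  also have "\<dots> = (\<Sum>b<n. v b * (\<Sum>k<n. e k a * cnj (e k b)))"
    by (subst sum.swap) (simp add: sum_distrib_left)
  also have "\<dots> = (\<Sum>b<n. if a = b then v b else 0)"
    using assms by (intro sum.cong) (simp_all add: orthonormal_complete)
  finally show ?thesis
    using assms by simp
qed

lemma orthonormal_parseval:
  assumes "orthonormal n n e"
  shows "inner n v w = (\<Sum>k<n. inner n v (e k) * inner n (e k) w)"
proof -
  have "inner n v w = inner n (\<lambda>a. \<Sum>k<n. inner n v (e k) * e k a) w"
    using orthonormal_expand[OF assms] by (simp cong: inner_cong)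
  then show ?thesis
    by (simp add: inner_sum_left inner_scale_left)
qed

lemma inner_mult_commute: "inner n v w * inner n w v = complex_of_real ((cmod (inner n v w))\<^sup>2)"
  by (subst inner_commute[of n w v]) (simp only: complex_norm_square)

lemma orthonormal_parseval_norm:
  assumes "orthonormal n n e"
  shows "(\<Sum>a<n. (cmod (v a))\<^sup>2) = (\<Sum>k<n. (cmod (inner n v (e k)))\<^sup>2)"
proof -
  have "complex_of_real (\<Sum>a<n. (cmod (v a))\<^sup>2) = complex_of_real (\<Sum>k<n. (cmod (inner n v (e k)))\<^sup>2)"
    using inner_self[of n v] orthonormal_parseval[OF assms, of v v] by (simp only: inner_mult_commute of_real_sum)
  then show ?thesis
    by (simp only: of_real_eq_iff)
qed

lemma cmod_inner_commute: "cmod (inner n v w) = cmod (inner n w v)"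
  by (subst inner_commute) simp

lemma orthonormal_sum_cmod_inner:
  assumes "orthonormal n n e" "inner n v v = 1"
  shows "(\<Sum>k<n. (cmod (inner n v (e k)))\<^sup>2) = 1" "(\<Sum>k<n. (cmod (inner n (e k) v))\<^sup>2) = 1"
proof -
  have "complex_of_real (\<Sum>a<n. (cmod (v a))\<^sup>2) = complex_of_real 1"
    using assms(2) unfolding inner_self by simp
  then show "(\<Sum>k<n. (cmod (inner n v (e k)))\<^sup>2) = 1"
    unfolding orthonormal_parseval_norm[OF assms(1), of v] of_real_eq_iff .
  then show "(\<Sum>k<n. (cmod (inner n (e k) v))\<^sup>2) = 1"
    unfolding cmod_inner_commute[of n v] .
qed

lemma spectral_app:
  assumes "spectral n A e d" "a < n"
  shows "app n A v a = (\<Sum>k<n. d k * inner n v (e k) * e k a)"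
proof -
  have "app n A v a = (\<Sum>b<n. \<Sum>k<n. d k * e k a * cnj (e k b) * v b)"
    using assms by (simp add: spectral_def app_def sum_distrib_right)
  also have "\<dots> = (\<Sum>k<n. \<Sum>b<n. d k * e k a * cnj (e k b) * v b)"
    by (rule sum.swap)
  also have "\<dots> = (\<Sum>k<n. d k * inner n v (e k) * e k a)"
    by (simp add: inner_def sum_distrib_right sum_distrib_left mult_ac)
  finally show ?thesis .
qed

lemma spectral_eigen:
  assumes "spectral n A e d" "a < n" "i < n"
  shows "app n A (e i) a = d i * e i a"
proof -
  have "app n A (e i) a = (\<Sum>k<n. if i = k then d k * e k a else 0)"
    unfolding spectral_app[OF assms(1,2)]
    using assms by (intro sum.cong) (simp_all add: orthonormal_inner[OF spectral_orthonormal])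
  then show ?thesis
    using assms by simp
qed

text \<open>Inserting the completeness relation of \<open>e\<close> into \<open>A\<close> turns the
  eigenvalue equations into the entries demanded by \<open>spectral\<close>.\<close>

lemma spectralI:
  assumes A: "A \<in> carrier_mat n n" and e: "orthonormal n n e"
    and d: "\<And>i a. i < n \<Longrightarrow> a < n \<Longrightarrow> app n A (e i) a = complex_of_real (d i) * e i a"
  shows "spectral n A e d"
proof -
  have "A $$ (a, b) = (\<Sum>k<n. complex_of_real (d k) * e k a * cnj (e k b))" if "a < n" "b < n" for a b
  proof -
    have "(\<Sum>k<n. complex_of_real (d k) * e k a * cnj (e k b)) = (\<Sum>k<n. \<Sum>c<n. A $$ (a, c) * (e k c * cnj (e k b)))"
      using d that by (simp flip: d add: app_def sum_distrib_right mult.assoc)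
    also have "\<dots> = (\<Sum>c<n. A $$ (a, c) * (\<Sum>k<n. e k c * cnj (e k b)))"
      by (subst sum.swap) (simp add: sum_distrib_left)
    also have "\<dots> = A $$ (a, b)"
      using that by (simp add: orthonormal_complete[OF e] if_distrib cong: if_cong)
    finally show ?thesis by simp
  qed
  then show ?thesis
    using A e unfolding spectral_def by blast
qed

lemma spectral_theorem:
  assumes "hermitian n A"
  obtains e d where "spectral n A e d"
proof -
  obtain e d where e: "orthonormal n n e" "\<And>i a. i < n \<Longrightarrow> a < n \<Longrightarrow> app n A (e i) a = complex_of_real (d i) * e i a"
    using hermitian_eigenvectors[OF assms order.refl] by auto
  then have "spectral n A e d"
    using assms by (intro spectralI) (auto simp: hermitian_def)
  then show ?thesis
    using that by blast
qed

lemma spectral_inner_app: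
  assumes "spectral n A e d" "i < n"
  shows "inner n (app n A v) (e i) = d i * inner n v (e i)"
proof -
  have "inner n (app n A v) (e i) = inner n (\<lambda>a. \<Sum>k<n. (d k * inner n v (e k)) * e k a) (e i)"
    using spectral_app[OF assms(1)] by (simp cong: inner_cong)
  also have "\<dots> = (\<Sum>k<n. if i = k then d k * inner n v (e k) else 0)"
    unfolding inner_sum_left inner_scale_left
    using assms by (intro sum.cong) (simp_all add: orthonormal_inner[OF spectral_orthonormal])
  finally show ?thesis
    using assms by simp
qed

lemma spectral_quadratic_form:
  assumes "spectral n A e d"
  shows "inner n (app n A v) v = complex_of_real (\<Sum>k<n. d k * (cmod (inner n v (e k)))\<^sup>2)"
proof -
  have "inner n (app n A v) v = (\<Sum>k<n. d k * (inner n v (e k) * inner n (e k) v))"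
    by (subst orthonormal_parseval[OF spectral_orthonormal[OF assms]])
      (simp add: spectral_inner_app[OF assms] mult.assoc)
  then show ?thesis
    by (simp only: inner_mult_commute of_real_sum of_real_mult)
qed

section \<open>Well-definedness of matrix functions\<close>

lemma mat_adjoint_index:
  assumes "U \<in> carrier_mat n n" "i < n" "j < n"
  shows "mat_adjoint U $$ (i, j) = cnj (U $$ (j, i))"
  using assms by (simp add: mat_adjoint_def mat_of_rows_index)

lemma mat_adjoint_carrier: "U \<in> carrier_mat n n \<Longrightarrow> mat_adjoint U \<in> carrier_mat n n"
  by (auto simp: mat_adjoint_def)

lemma unitary_conj_index:
  assumes U: "U \<in> carrier_mat n n" and ab: "a < n" "b < n"
  shows "(U * mat_diag n (\<lambda>i. complex_of_real (d i)) * mat_adjoint U) $$ (a, b) =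
    (\<Sum>k<n. d k * U $$ (a, k) * cnj (U $$ (b, k)))"
  unfolding mat_diag_mult_right[OF U]
  using assms mat_adjoint_carrier[OF U]
  by (simp add: scalar_prod_def atLeast0LessThan mat_adjoint_index mult_ac)

lemma unitary_iff_orthonormal:
  "unitary_mat n U \<longleftrightarrow> U \<in> carrier_mat n n \<and> orthonormal n n (\<lambda>k a. U $$ (a, k))"
proof (cases "U \<in> carrier_mat n n")
  case True
  have "(mat_adjoint U * U) $$ (i, j) = inner n (\<lambda>a. U $$ (a, j)) (\<lambda>a. U $$ (a, i))" if "i < n" "j < n" for i j
    using that True mat_adjoint_carrier[OF True]
    by (simp add: scalar_prod_def atLeast0LessThan mat_adjoint_index inner_def mult_ac)
  then show ?thesis
    using True mat_adjoint_carrier[OF True]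
    by (auto simp: unitary_mat_def orthonormal_def mat_eq_iff)
qed (simp add: unitary_mat_def)

lemma spectral_iff_unitary:
  assumes "unitary_mat n U"
  shows "A = U * mat_diag n (\<lambda>i. complex_of_real (d i)) * mat_adjoint U \<longleftrightarrow> spectral n A (\<lambda>k a. U $$ (a, k)) d"
proof -
  have U: "U \<in> carrier_mat n n" and o: "orthonormal n n (\<lambda>k a. U $$ (a, k))"
    using assms by (auto simp: unitary_iff_orthonormal)
  have "U * mat_diag n (\<lambda>i. complex_of_real (d i)) * mat_adjoint U \<in> carrier_mat n n"
    (is "?B \<in> _")
    using U mat_adjoint_carrier[OF U] by (meson mat_diag_dim mult_carrier_mat)
  moreover have "A = ?B \<longleftrightarrow> (\<forall>a<n. \<forall>b<n. A $$ (a, b) = ?B $$ (a, b))" if "A \<in> carrier_mat n n"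
    using that \<open>?B \<in> _\<close> by (auto simp only: mat_eq_iff carrier_matD)
  ultimately show ?thesis
    using o by (auto simp only: spectral_def unitary_conj_index[OF U])
qed

text \<open>The two eigenbases may differ, but \<open>e k\<close> and \<open>e' i\<close> overlap
  only if \<open>d k = d' i\<close>. So when \<open>e k\<close> is expanded over \<open>e'\<close>,
  every contributing term carries the value \<open>f (d k)\<close>, and \<open>B'\<close> acts on
  \<open>e k\<close> as \<open>B\<close> does.\<close>

lemma spectral_map_unique:
  assumes "spectral n A e d" "spectral n A e' d'"
    and B: "spectral n B e (\<lambda>k. f (d k))" and B': "spectral n B' e' (\<lambda>k. f (d' k))"
  shows "B = B'"
proof -
  have o: "orthonormal n n e" and o': "orthonormal n n e'"
    using assms by (auto simp: spectral_def)
  have "app n B' (e k) a = f (d k) * e k a" if "k < n" "a < n" for k a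
  proof -
    have "f (d' i) * inner n (e k) (e' i) = f (d k) * inner n (e k) (e' i)" if "i < n" for i
    proof -
      have "d' i * inner n (e k) (e' i) = inner n (app n A (e k)) (e' i)"
        using spectral_inner_app[OF assms(2) that] by simp
      also have "\<dots> = d k * inner n (e k) (e' i)"
        using spectral_eigen[OF assms(1) _ \<open>k < n\<close>] by (simp add: inner_scale_left cong: inner_cong)
      finally show ?thesis
        by auto
    qed
    then have "app n B' (e k) a = (\<Sum>i<n. f (d k) * (inner n (e k) (e' i) * e' i a))"
      unfolding spectral_app[OF B' \<open>a < n\<close>] by (intro sum.cong) (simp_all flip: mult.assoc)
    then show ?thesis
      using orthonormal_expand[OF o' \<open>a < n\<close>] by (simp flip: sum_distrib_left)
  qed
  then have "spectral n B' e (\<lambda>k. f (d k))"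
    using B' o by (intro spectralI) (auto simp: spectral_def)
  then show ?thesis
    using B by (auto simp: spectral_def mat_eq_iff)
qed

text \<open>Justifies the definite description in \<open>mat_fun\<close>: existence comes from the
  unitary whose columns are the eigenvectors, uniqueness from
  \<open>spectral_map_unique\<close>.\<close>

lemma spectral_mat_fun:
  assumes A: "spectral n A e d"
  shows "spectral n (mat_fun f A) e (\<lambda>k. f (d k))"
proof -
  define U where "U = mat n n (\<lambda>(a, k). e k a)"
  have U: "orthonormal n n (\<lambda>k a. U $$ (a, k))"
    using A by (auto simp: spectral_def orthonormal_def inner_def U_def)
  then have unitary: "unitary_mat n U"
    by (simp add: unitary_iff_orthonormal U_def)
  have spec_eq: "spectral n C (\<lambda>k a. U $$ (a, k)) d \<longleftrightarrow> spectral n C e d" for C d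
    using A U by (simp add: spectral_def U_def)
  define B where "B = U * mat_diag n (\<lambda>i. complex_of_real (f (d i))) * mat_adjoint U"
  have B: "spectral n B e (\<lambda>k. f (d k))"
    using spectral_iff_unitary[OF unitary] B_def spec_eq by blast
  have "mat_fun f A = B"
    unfolding mat_fun_def
  proof (rule the_equality)
    have "dim_row A = n"
      using A by (auto simp: spectral_def)
    then show "\<exists>U d. unitary_mat (dim_row A) U \<and>
      A = U * mat_diag (dim_row A) (\<lambda>i. complex_of_real (d i)) * mat_adjoint U \<and>
      B = U * mat_diag (dim_row A) (\<lambda>i. complex_of_real (f (d i))) * mat_adjoint U"
      using unitary spectral_iff_unitary[OF unitary] B_def spec_eq A by blast
    fix B' assume "\<exists>U d. unitary_mat (dim_row A) U \<and>
      A = U * mat_diag (dim_row A) (\<lambda>i. complex_of_real (d i)) * mat_adjoint U \<and>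
      B' = U * mat_diag (dim_row A) (\<lambda>i. complex_of_real (f (d i))) * mat_adjoint U"
    then obtain V d' where "unitary_mat n V"
      "A = V * mat_diag n (\<lambda>i. complex_of_real (d' i)) * mat_adjoint V"
      "B' = V * mat_diag n (\<lambda>i. complex_of_real (f (d' i))) * mat_adjoint V"
      unfolding \<open>dim_row A = n\<close> by blast
    then have "spectral n A (\<lambda>k a. V $$ (a, k)) d'" "spectral n B' (\<lambda>k a. V $$ (a, k)) (\<lambda>k. f (d' k))"
      by (simp_all flip: spectral_iff_unitary)
    then show "B' = B"
      using spectral_map_unique[OF A _ B] by metis
  qed
  then show ?thesis
    using B by simp
qed

section \<open>Supports in terms of eigenbases\<close>

lemma cscalar_prod_eq_inner: "w \<in> carrier_vec n \<Longrightarrow> v \<bullet>c w = inner n (($) v) (($) w)"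
  by (simp add: scalar_prod_def inner_def atLeast0LessThan)

lemma mult_mat_vec_index_app:
  "A \<in> carrier_mat n n \<Longrightarrow> v \<in> carrier_vec n \<Longrightarrow> a < n \<Longrightarrow> (A *\<^sub>v v) $ a = app n A (($) v) a"
  by (simp add: app_def scalar_prod_def atLeast0LessThan)

text \<open>The kernel is spanned by the eigenvectors of eigenvalue zero, so orthogonality to it
  need only be tested on these.\<close>

lemma supp_spectral:
  assumes A: "spectral n A e d"
  shows "v \<in> supp A \<longleftrightarrow> v \<in> carrier_vec n \<and> (\<forall>k<n. d k = 0 \<longrightarrow> inner n (($) v) (e k) = 0)"
proof
  have Ac: "A \<in> carrier_mat n n"
    using A by (simp add: spectral_def)
  show "v \<in> carrier_vec n \<and> (\<forall>k<n. d k = 0 \<longrightarrow> inner n (($) v) (e k) = 0)" if v: "v \<in> supp A"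
  proof (intro conjI allI impI)
    show "v \<in> carrier_vec n"
      using v Ac by (auto simp: supp_def)
    fix k assume k: "k < n" "d k = 0"
    have "app n A (($) (vec n (e k))) a = 0" if "a < n" for a
      using spectral_eigen[OF A that k(1)] k(2) by (simp add: app_def)
    then have "A *\<^sub>v vec n (e k) = 0\<^sub>v n"
      using Ac by (intro eq_vecI) (auto simp: mult_mat_vec_index_app simp del: index_mult_mat_vec)
    then have "vec n (e k) \<in> mat_kernel A"
      using Ac by (intro mat_kernelI) auto
    then have "v \<bullet>c vec n (e k) = 0"
      using v by (auto simp: supp_def)
    then show "inner n (($) v) (e k) = 0"
      by (simp add: cscalar_prod_eq_inner[of _ n] inner_def)
  qed
  assume v: "v \<in> carrier_vec n \<and> (\<forall>k<n. d k = 0 \<longrightarrow> inner n (($) v) (e k) = 0)"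
  have "v \<bullet>c w = 0" if w: "w \<in> mat_kernel A" for w
  proof -
    have wc: "w \<in> carrier_vec n" "A *\<^sub>v w = 0\<^sub>v n"
      using mat_kernelD[OF Ac w] by auto
    have "app n A (($) w) a = 0" if "a < n" for a
      using mult_mat_vec_index_app[OF Ac wc(1) that] that wc(2) by simp
    then have "d k * inner n (($) w) (e k) = 0" if "k < n" for k
      using spectral_inner_app[OF A that, of "($) w"] by (simp add: inner_def)
    then have "d k = 0 \<or> inner n (e k) (($) w) = 0" if "k < n" for k
      using that inner_commute[of n "e k" "($) w"] by fastforce
    then have "inner n (($) v) (($) w) = 0"
      using v by (subst orthonormal_parseval[OF spectral_orthonormal[OF A]], intro sum.neutral) fastforce
    then show ?thesis
      using wc by (simp add: cscalar_prod_eq_inner)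
  qed
  then show "v \<in> supp A"
    using v Ac by (auto simp: supp_def)
qed

text \<open>The eigenvectors of \<open>A\<close> with nonzero eigenvalue lie in
  \<open>supp A\<close> and span it, so testing them against the null eigenvectors of
  \<open>B\<close> decides the inclusion.\<close>

lemma supp_subset_spectral:
  assumes A: "spectral n A e r" and B: "spectral n B f s"
  shows "supp A \<subseteq> supp B \<longleftrightarrow> (\<forall>i<n. \<forall>j<n. r i \<noteq> 0 \<longrightarrow> s j = 0 \<longrightarrow> inner n (e i) (f j) = 0)"
proof (intro iffI allI impI)
  fix i j assume *: "supp A \<subseteq> supp B" "i < n" "j < n" "r i \<noteq> 0" "s j = 0"
  have vec: "inner n (($) (vec n (e i))) w = inner n (e i) w" for w
    by (rule inner_cong) simp_all
  have "inner n (e i) (e k) = 0" if "k < n" "r k = 0" for k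
    using orthonormal_inner[OF spectral_orthonormal[OF A]] that * by auto
  then have "vec n (e i) \<in> supp A"
    unfolding supp_spectral[OF A] vec by simp
  then have "vec n (e i) \<in> supp B"
    using * by auto
  then show "inner n (e i) (f j) = 0"
    using * unfolding supp_spectral[OF B] vec by simp
next
  assume *: "\<forall>i<n. \<forall>j<n. r i \<noteq> 0 \<longrightarrow> s j = 0 \<longrightarrow> inner n (e i) (f j) = 0"
  show "supp A \<subseteq> supp B"
  proof
    fix v assume v: "v \<in> supp A"
    have "inner n (($) v) (f j) = 0" if "j < n" "s j = 0" for j
      using v * that unfolding supp_spectral[OF A]
      by (subst orthonormal_parseval[OF spectral_orthonormal[OF A]], intro sum.neutral) force
    then show "v \<in> supp B"
      using v unfolding supp_spectral[OF A] supp_spectral[OF B] by simp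
  qed
qed

section \<open>Relative entropy\<close>

text \<open>
  Since \<open>0 * \<infinity> = 0\<close> in \<^typ>\<open>ereal\<close>, the value \<open>\<infinity>\<close> matters only for non-orthogonal eigenvectors,
  which is exactly the failure of the support condition.
\<close>

definition kl :: "real \<Rightarrow> real \<Rightarrow> ereal" where
  "kl r s = (if r = 0 then 0 else if s = 0 then \<infinity> else ereal (r * (ln r - ln s)))"

lemma mtrace_mult_spectral:
  assumes A: "spectral n A e d" and X: "X \<in> carrier_mat n n"
  shows "mtrace (A * X) = (\<Sum>k<n. d k * inner n (app n X (e k)) (e k))"
proof -
  have "mtrace (A * X) = mtrace (X * A)"
    using mtrace_mult_comm[OF spectral_carrier[OF A] X] .
  also have "\<dots> = (\<Sum>a<n. \<Sum>b<n. X $$ (a, b) * A $$ (b, a))"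
    using X spectral_carrier[OF A] by (simp add: mtrace_def scalar_prod_def atLeast0LessThan)
  also have "\<dots> = (\<Sum>a<n. \<Sum>b<n. \<Sum>k<n. d k * (X $$ (a, b) * e k b * cnj (e k a)))"
    using A by (simp add: spectral_def sum_distrib_left mult_ac)
  also have "\<dots> = (\<Sum>a<n. \<Sum>k<n. \<Sum>b<n. d k * (X $$ (a, b) * e k b * cnj (e k a)))"
    by (intro sum.cong refl sum.swap)
  also have "\<dots> = (\<Sum>k<n. \<Sum>a<n. \<Sum>b<n. d k * (X $$ (a, b) * e k b * cnj (e k a)))"
    by (rule sum.swap)
  also have "\<dots> = (\<Sum>k<n. d k * inner n (app n X (e k)) (e k))"
    by (simp add: inner_app_eq sum_distrib_left)
  finally show ?thesis .
qed

lemma relative_entropy_spectral: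
  assumes A: "spectral n \<rho> e r" and B: "spectral n \<sigma> f s"
  shows "relative_entropy \<rho> \<sigma> = (\<Sum>i<n. \<Sum>j<n. ereal ((cmod (inner n (e i) (f j)))\<^sup>2) * kl (r i) (s j))"
proof (cases "supp \<rho> \<subseteq> supp \<sigma>")
  case True
  define l where "l x = (if x = 0 then 0 else ln x)" for x :: real
  define P where "P i j = (cmod (inner n (e i) (f j)))\<^sup>2" for i j
  have P: "(\<Sum>j<n. P i j) = 1" if "i < n" for i
    unfolding P_def
    using orthonormal_sum_cmod_inner(1)[OF spectral_orthonormal[OF B]] orthonormal_inner[OF spectral_orthonormal[OF A] that that]
    by simp
  have LA: "spectral n (mat_log \<rho>) e (\<lambda>k. l (r k))" and LB: "spectral n (mat_log \<sigma>) f (\<lambda>k. l (s k))"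
    unfolding mat_log_def l_def by (rule spectral_mat_fun[OF A], rule spectral_mat_fun[OF B])
  have X: "mat_log \<rho> - mat_log \<sigma> \<in> carrier_mat n n"
    using LA LB by (auto simp: spectral_def)
  have "inner n (app n (mat_log \<rho> - mat_log \<sigma>) (e i)) (e i) = complex_of_real (\<Sum>j<n. P i j * (l (r i) - l (s j)))"
    if "i < n" for i
  proof -
    have "inner n (app n (mat_log \<rho> - mat_log \<sigma>) (e i)) (e i) =
        inner n (app n (mat_log \<rho>) (e i)) (e i) - inner n (app n (mat_log \<sigma>) (e i)) (e i)"
      using app_diff[OF spectral_carrier[OF LA] spectral_carrier[OF LB]]
      by (simp add: inner_diff_left cong: inner_cong)
    also have "inner n (app n (mat_log \<rho>) (e i)) (e i) = l (r i)"
      unfolding spectral_inner_app[OF LA that] orthonormal_inner[OF spectral_orthonormal[OF A] that that] by simp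
    also have "inner n (app n (mat_log \<sigma>) (e i)) (e i) = (\<Sum>j<n. l (s j) * P i j)"
      unfolding spectral_quadratic_form[OF LB] P_def ..
    \<comment> \<open>Multiplying \<open>l (r i)\<close> by the total weight \<open>1\<close> of row
      \<open>i\<close> of \<open>P\<close> puts both logarithms under one sum over
      \<open>j\<close>.\<close>
    finally have "inner n (app n (mat_log \<rho> - mat_log \<sigma>) (e i)) (e i) =
        complex_of_real (l (r i) * (\<Sum>j<n. P i j) - (\<Sum>j<n. l (s j) * P i j))"
      using P[OF that] by simp
    then show ?thesis
      by (simp only: sum_distrib_left sum_subtractf[symmetric] right_diff_distrib mult.commute)
  qed
  then have "mtrace (\<rho> * (mat_log \<rho> - mat_log \<sigma>)) = complex_of_real (\<Sum>i<n. r i * (\<Sum>j<n. P i j * (l (r i) - l (s j))))"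
    unfolding mtrace_mult_spectral[OF A X] by simp
  then have "relative_entropy \<rho> \<sigma> = ereal (\<Sum>i<n. r i * (\<Sum>j<n. P i j * (l (r i) - l (s j))))"
    using True by (simp add: relative_entropy_def)
  also have "\<dots> = (\<Sum>i<n. \<Sum>j<n. ereal (r i * (P i j * (l (r i) - l (s j)))))"
    by (simp add: sum_distrib_left)
  \<comment> \<open>\<open>kl\<close> is infinite only for \<open>r i \<noteq> 0\<close> and
    \<open>s j = 0\<close>; there the support condition gives \<open>P i j = 0\<close>, and both
    sides are zero.\<close>
  also have "\<dots> = (\<Sum>i<n. \<Sum>j<n. ereal (P i j) * kl (r i) (s j))"
    using True unfolding supp_subset_spectral[OF A B]
    by (intro sum.cong refl) (auto simp: kl_def l_def P_def)
  finally show ?thesis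
    unfolding P_def .
next
  case False
  then obtain i j where ij: "i < n" "j < n" "r i \<noteq> 0" "s j = 0" "inner n (e i) (f j) \<noteq> 0"
    unfolding supp_subset_spectral[OF A B] by blast
  then have "ereal ((cmod (inner n (e i) (f j)))\<^sup>2) * kl (r i) (s j) = \<infinity>"
    by (simp add: kl_def)
  then have "(\<Sum>j<n. ereal ((cmod (inner n (e i) (f j)))\<^sup>2) * kl (r i) (s j)) = \<infinity>"
    using ij(2) unfolding sum_Pinfty by blast
  then have "(\<Sum>i<n. \<Sum>j<n. ereal ((cmod (inner n (e i) (f j)))\<^sup>2) * kl (r i) (s j)) = \<infinity>"
    using ij(1) unfolding sum_Pinfty[of _ "{..<n}"] by blast
  then show ?thesis
    using False by (simp add: relative_entropy_def)
qed

section \<open>Positive semidefinite matrices and domination\<close>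

definition delta :: "nat \<Rightarrow> nat \<Rightarrow> complex" where
  "delta a b = (if a = b then 1 else 0)"

lemma app_add_right: "app n A (\<lambda>b. v b + w b) a = app n A v a + app n A w a"
  by (simp add: app_def sum.distrib ring_distribs)

lemma app_scale_right: "app n A (\<lambda>b. c * v b) a = c * app n A v a"
  by (simp add: app_def sum_distrib_left mult_ac)

lemma app_delta: "a < n \<Longrightarrow> app n A (delta a) b = A $$ (b, a)"
  by (simp add: app_def delta_def if_distrib cong: if_cong)

lemma inner_delta_right: "a < n \<Longrightarrow> inner n v (delta a) = v a"
  by (simp add: inner_def delta_def if_distrib cong: if_cong)

lemma inner_add_right: "inner n x (\<lambda>a. v a + w a) = inner n x v + inner n x w"
  by (simp add: inner_def sum.distrib ring_distribs)

lemma psd_iff: "psd n A \<longleftrightarrow> A \<in> carrier_mat n n \<and> (\<forall>v. 0 \<le> inner n (app n A v) v)"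
proof (cases "A \<in> carrier_mat n n")
  case A: True
  have form: "(A *\<^sub>v v) \<bullet>c v = inner n (app n A (($) v)) (($) v)" if "v \<in> carrier_vec n" for v
    using A that mult_mat_vec_index_app[OF A that]
    by (simp add: cscalar_prod_eq_inner[of v n] cong: inner_cong del: index_mult_mat_vec)
  have vec: "inner n (app n A v) v = inner n (app n A (($) (vec n v))) (($) (vec n v))" for v
    by (simp add: inner_app_eq)
  show ?thesis
    unfolding psd_def using A form vec by (metis vec_carrier)
qed (simp add: psd_def)

lemma psd_carrier: "psd n A \<Longrightarrow> A \<in> carrier_mat n n"
  by (simp add: psd_def)

text \<open>Polarization: evaluating the real quadratic form at the vector \<open>delta a\<close>
  plus \<open>c\<close> times \<open>delta b\<close>, with \<open>c = 1\<close> and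
  \<open>c = \<i>\<close>, yields the imaginary and the real part of the symmetry.\<close>

lemma psd_hermitian:
  assumes "psd n A"
  shows "hermitian n A"
proof -
  have real: "Im (inner n (app n A v) v) = 0" for v
    using assms unfolding psd_iff by (metis less_eq_complex_def zero_complex.sel(2))
  have "A $$ (b, a) = cnj (A $$ (a, b))" if ab: "a < n" "b < n" for a b
  proof -
    have *: "Im (c * A $$ (a, b) + cnj c * A $$ (b, a)) = 0" for c
    proof -
      have "inner n (app n A (\<lambda>x. delta a x + c * delta b x)) (\<lambda>x. delta a x + c * delta b x)
          = A $$ (a, a) + c * A $$ (a, b) + cnj c * A $$ (b, a) + (c * cnj c) * A $$ (b, b)"
        using ab
        by (simp add: app_add_right app_scale_right inner_add_left inner_add_right inner_scale_right
            inner_scale_left app_delta inner_delta_right ring_distribs)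
      moreover have "Im (A $$ (x, x)) = 0" if "x < n" for x
        using real[of "delta x"] that by (simp add: app_delta inner_delta_right)
      moreover have "c * cnj c = complex_of_real ((cmod c)\<^sup>2)"
        by (simp only: complex_norm_square)
      ultimately show ?thesis
        using real[of "\<lambda>x. delta a x + c * delta b x"] ab by simp
    qed
    show ?thesis
      using *[of 1] *[of \<i>] by (simp add: complex_eq_iff)
  qed
  then show ?thesis
    unfolding hermitian_def using psd_carrier[OF assms] by blast
qed

lemma psd_spectral:
  assumes "psd n A"
  obtains e d where "spectral n A e d" "\<And>k. k < n \<Longrightarrow> 0 \<le> d k"
proof -
  obtain e d where ed: "spectral n A e d"
    using spectral_theorem[OF psd_hermitian[OF assms]] .
  have "0 \<le> d k" if "k < n" for k
  proof -
    have "0 \<le> inner n (app n A (e k)) (e k)"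
      using assms by (simp add: psd_iff)
    then show ?thesis
      using that orthonormal_inner[OF spectral_orthonormal[OF ed] that that]
      by (simp add: spectral_inner_app[OF ed] less_eq_complex_def)
  qed
  then show ?thesis
    using that ed by blast
qed

lemma mtrace_orthonormal:
  assumes A: "A \<in> carrier_mat n n" and e: "orthonormal n n e"
  shows "mtrace A = (\<Sum>k<n. inner n (app n A (e k)) (e k))"
proof -
  have "(\<Sum>k<n. inner n (app n A (e k)) (e k)) = (\<Sum>a<n. \<Sum>k<n. \<Sum>b<n. A $$ (a, b) * e k b * cnj (e k a))"
    unfolding inner_app_eq by (rule sum.swap)
  also have "\<dots> = (\<Sum>a<n. \<Sum>b<n. \<Sum>k<n. A $$ (a, b) * e k b * cnj (e k a))"
    by (intro sum.cong refl sum.swap)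
  also have "\<dots> = (\<Sum>a<n. \<Sum>b<n. A $$ (a, b) * (\<Sum>k<n. e k b * cnj (e k a)))"
    by (simp add: sum_distrib_left mult.assoc)
  also have "\<dots> = (\<Sum>a<n. \<Sum>b<n. if b = a then A $$ (a, b) else 0)"
    using e by (intro sum.cong refl) (simp add: orthonormal_complete)
  also have "\<dots> = mtrace A"
    using A by (simp add: mtrace_def)
  finally show ?thesis ..
qed

lemma mtrace_spectral:
  assumes "spectral n A e d"
  shows "mtrace A = complex_of_real (\<Sum>k<n. d k)"
  using assms orthonormal_inner[OF spectral_orthonormal[OF assms]]
  by (simp add: mtrace_orthonormal[OF spectral_carrier spectral_orthonormal] spectral_inner_app)

lemma app_smult:
  "A \<in> carrier_mat n n \<Longrightarrow> a < n \<Longrightarrow> app n (c \<cdot>\<^sub>m A) v a = c * app n A v a"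
  by (simp add: app_def sum_distrib_left mult.assoc)

lemma app_add:
  "A \<in> carrier_mat n n \<Longrightarrow> B \<in> carrier_mat n n \<Longrightarrow> a < n \<Longrightarrow> app n (A + B) v a = app n A v a + app n B v a"
  by (simp add: app_def sum.distrib ring_distribs)

lemma inner_app_diff_smult:
  assumes "A \<in> carrier_mat n n" "B \<in> carrier_mat n n"
  shows "inner n (app n (A - c \<cdot>\<^sub>m B) v) w = inner n (app n A v) w - c * inner n (app n B v) w"
  using assms by (simp add: app_diff app_smult inner_diff_left inner_scale_left cong: inner_cong)

text \<open>On an eigenvector of \<open>B\<close> with eigenvalue zero, the form of the difference
  is \<open>- c\<close> times that of \<open>A\<close>. Both forms are nonnegative, so that of
  \<open>A\<close> vanishes, and with it every overlap with an eigenvector of \<open>A\<close> of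
  positive eigenvalue.\<close>

lemma supp_subset_of_psd_diff:
  assumes A: "psd n A" and B: "psd n B" and c: "0 < c" and dom: "psd n (B - complex_of_real c \<cdot>\<^sub>m A)"
  shows "supp A \<subseteq> supp B"
proof -
  obtain e r where er: "spectral n A e r" "\<And>k. k < n \<Longrightarrow> 0 \<le> r k"
    using psd_spectral[OF A] by blast
  obtain f s where fs: "spectral n B f s" "\<And>k. k < n \<Longrightarrow> 0 \<le> s k"
    using psd_spectral[OF B] by blast
  have "inner n (e i) (f j) = 0" if ij: "i < n" "j < n" "r i \<noteq> 0" "s j = 0" for i j
  proof -
    have "0 \<le> inner n (app n (B - complex_of_real c \<cdot>\<^sub>m A) (f j)) (f j)"
      using dom by (simp add: psd_iff)
    also have "\<dots> = - complex_of_real (c * (\<Sum>k<n. r k * (cmod (inner n (f j) (e k)))\<^sup>2))"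
      using ij fs(1) A B
      by (simp add: inner_app_diff_smult psd_carrier spectral_inner_app[OF fs(1)] spectral_quadratic_form[OF er(1)])
    finally have "(\<Sum>k<n. r k * (cmod (inner n (f j) (e k)))\<^sup>2) \<le> 0"
      using c by (simp add: less_eq_complex_def mult_le_0_iff del: of_real_sum of_real_mult)
    moreover have "r i * (cmod (inner n (f j) (e i)))\<^sup>2 \<le> (\<Sum>k<n. r k * (cmod (inner n (f j) (e k)))\<^sup>2)"
      using ij er(2) by (intro member_le_sum) auto
    ultimately have "r i * (cmod (inner n (f j) (e i)))\<^sup>2 \<le> 0"
      by linarith
    moreover have "r i > 0"
      using ij er(2)[of i] by simp
    ultimately have "inner n (f j) (e i) = 0"
      by (simp add: mult_le_0_iff)
    then show ?thesis
      using cmod_inner_commute[of n "e i" "f j"] by simp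
  qed
  then show ?thesis
    using supp_subset_spectral[OF er(1) fs(1)] by blast
qed

text \<open>Converse of \<open>supp_subset_of_psd_diff\<close>. Together they recast support
  inclusion as domination up to a positive factor, which positive linear maps preserve.\<close>

lemma psd_diff_of_supp_subset:
  assumes A: "psd n A" and B: "psd n B" and supp: "supp A \<subseteq> supp B"
  obtains c where "0 < c" "psd n (B - complex_of_real c \<cdot>\<^sub>m A)"
proof -
  obtain e r where er: "spectral n A e r" "\<And>k. k < n \<Longrightarrow> 0 \<le> r k"
    using psd_spectral[OF A] by blast
  obtain f s where fs: "spectral n B f s" "\<And>k. k < n \<Longrightarrow> 0 \<le> s k"
    using psd_spectral[OF B] by blast
  note oe = spectral_orthonormal[OF er(1)] and of = spectral_orthonormal[OF fs(1)]
  \<comment> \<open>\<open>R\<close> bounds the eigenvalues of \<open>A\<close>, and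
    \<open>K\<close> bounds the reciprocals of the nonzero eigenvalues of \<open>B\<close>. Sums
    serve as crude maxima that make sense for \<open>n = 0\<close> as well.\<close>
  define R where "R = (\<Sum>k<n. r k)"
  define K where "K = (\<Sum>j<n. if s j = 0 then 0 else 1 / s j)"
  have R: "r k \<le> R" "0 \<le> R" if "k < n" for k
    unfolding R_def using that er(2) by (auto intro!: member_le_sum sum_nonneg)
  have K0: "0 \<le> K"
    unfolding K_def using fs(2) by (auto intro!: sum_nonneg)
  have K: "1 \<le> K * s j" if "j < n" "s j \<noteq> 0" for j
  proof -
    have "(if s j = 0 then 0 else 1 / s j) \<le> K"
      unfolding K_def using that(1) fs(2) by (intro member_le_sum) auto
    then show ?thesis
      using that fs(2)[of j] by (auto simp: field_simps)
  qed
  have bound: "(\<Sum>k<n. r k * (cmod (inner n v (e k)))\<^sup>2) \<le> R * K * (\<Sum>j<n. s j * (cmod (inner n v (f j)))\<^sup>2)"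
    (is "?L \<le> _") for v
  proof -
    \<comment> \<open>the component of \<open>v\<close> in the support of \<open>B\<close>; the form of \<open>A\<close> only sees this component\<close>
    define w where "w a = (\<Sum>j<n. (if s j = 0 then 0 else inner n v (f j)) * f j a)" for a
    have wf: "inner n w (f j) = (if s j = 0 then 0 else inner n v (f j))" if "j < n" for j
    proof -
      have "inner n w (f j) = (\<Sum>k<n. if j = k then (if s k = 0 then 0 else inner n v (f k)) else 0)"
        unfolding w_def inner_sum_left inner_scale_left
        using that by (intro sum.cong) (simp_all add: orthonormal_inner[OF of])
      then show ?thesis
        using that by simp
    qed
    have "r k * (cmod (inner n v (e k)))\<^sup>2 \<le> R * (cmod (inner n w (e k)))\<^sup>2" if "k < n" for k
    proof (cases "r k = 0")
      case False
      have "inner n (f j) (e k) = 0" if "j < n" "s j = 0" for j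
        using False \<open>k < n\<close> that supp cmod_inner_commute[of n "f j" "e k"]
        unfolding supp_subset_spectral[OF er(1) fs(1)] by simp
      then have "inner n v (e k) = inner n w (e k)"
        using orthonormal_parseval[OF of, of v "e k"] orthonormal_parseval[OF of, of w "e k"]
        by (auto simp: wf intro!: sum.cong)
      then show ?thesis
        using R[OF that] by (simp add: mult_right_mono)
    qed (use R[OF that] in simp)
    then have "?L \<le> (\<Sum>k<n. R * (cmod (inner n w (e k)))\<^sup>2)"
      by (intro sum_mono) simp
    \<comment> \<open>The squared norm of \<open>w\<close> may be computed in either
      eigenbasis.\<close>
    also have "\<dots> = R * (\<Sum>j<n. (cmod (inner n w (f j)))\<^sup>2)"
      using orthonormal_parseval_norm[OF oe, of w] orthonormal_parseval_norm[OF of, of w]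
      by (simp flip: sum_distrib_left)
    also have "\<dots> \<le> R * (\<Sum>j<n. K * s j * (cmod (inner n v (f j)))\<^sup>2)"
    proof (cases "n = 0")
      case False
      have "(cmod (inner n w (f j)))\<^sup>2 \<le> K * s j * (cmod (inner n v (f j)))\<^sup>2" if "j < n" for j
        using wf[OF that] K[OF that] by (simp add: mult_right_mono[of 1 "K * s j", simplified])
      then show ?thesis
        using R(2) False by (intro mult_left_mono sum_mono) auto
    qed simp
    finally show ?thesis
      by (simp add: sum_distrib_left mult.assoc)
  qed
  \<comment> \<open>The summand \<open>1\<close> keeps the denominator positive when
    \<open>R * K = 0\<close>, for instance for \<open>A = 0\<close>.\<close>
  define c where "c = 1 / (R * K + 1)"
  have RK: "0 \<le> R * K"
    unfolding R_def using K0 er(2) by (intro mult_nonneg_nonneg sum_nonneg) auto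
  then have c: "0 < c" "c * (R * K) \<le> 1"
    by (auto simp: c_def field_simps)
  have "psd n (B - complex_of_real c \<cdot>\<^sub>m A)"
    unfolding psd_iff
  proof (intro conjI allI)
    show "B - complex_of_real c \<cdot>\<^sub>m A \<in> carrier_mat n n"
      using A B by (auto simp: psd_def)
    fix v
    define S where "S = (\<Sum>j<n. s j * (cmod (inner n v (f j)))\<^sup>2)"
    have "0 \<le> S"
      unfolding S_def using fs(2) by (auto intro!: sum_nonneg)
    have "c * (\<Sum>k<n. r k * (cmod (inner n v (e k)))\<^sup>2) \<le> c * (R * K) * S"
      using mult_left_mono[OF bound[of v], of c] c(1) by (simp add: S_def mult.assoc)
    also have "\<dots> \<le> S"
      using mult_right_mono[OF c(2) \<open>0 \<le> S\<close>] by simp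
    finally have "0 \<le> complex_of_real (S - c * (\<Sum>k<n. r k * (cmod (inner n v (e k)))\<^sup>2))"
      by (simp add: less_eq_complex_def del: of_real_diff)
    also have "\<dots> = inner n (app n (B - complex_of_real c \<cdot>\<^sub>m A) v) v"
      using A B by (simp add: inner_app_diff_smult psd_carrier S_def spectral_quadratic_form[OF er(1)]
        spectral_quadratic_form[OF fs(1)])
    finally show "0 \<le> inner n (app n (B - complex_of_real c \<cdot>\<^sub>m A) v) v" .
  qed
  then show ?thesis
    using that c(1) by blast
qed

section \<open>Klein's inequality and a quadratic upper bound\<close>

lemma kl_ge_diff: "0 \<le> r \<Longrightarrow> 0 \<le> s \<Longrightarrow> ereal (r - s) \<le> kl r s"
proof (cases "r = 0 \<or> s = 0")
  case False
  assume "0 \<le> r" "0 \<le> s"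
  then have "ln (s / r) \<le> s / r - 1"
    using False by (intro ln_le_minus_one) simp
  then have "r * (ln s - ln r) \<le> r * (s / r - 1)"
    using \<open>0 \<le> r\<close> \<open>0 \<le> s\<close> False by (intro mult_left_mono) (auto simp: ln_div)
  then show ?thesis
    using False by (simp add: kl_def field_simps)
qed (auto simp: kl_def)

text \<open>The bound \<open>ln x \<le> x - 1\<close>, now at \<open>r / s\<close> instead of
  \<open>s / r\<close>. The right-hand sides are the terms of the chi-square divergence.\<close>

lemma kl_le_chi_square: "0 \<le> r \<Longrightarrow> 0 < s \<Longrightarrow> kl r s \<le> ereal (r\<^sup>2 / s - r)"
proof (cases "r = 0")
  case False
  assume "0 \<le> r" "0 < s"
  then have "ln (r / s) \<le> r / s - 1"
    using False by (intro ln_le_minus_one) simp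
  then have "r * (ln r - ln s) \<le> r * (r / s - 1)"
    using \<open>0 \<le> r\<close> \<open>0 < s\<close> False by (intro mult_left_mono) (auto simp: ln_div)
  then show ?thesis
    using False \<open>0 < s\<close> by (simp add: kl_def field_simps power2_eq_square)
qed (simp add: kl_def)

text \<open>Klein's inequality. The overlaps \<open>P\<close> are doubly stochastic, so the lower
  bounds \<open>r i - s j\<close> of \<open>kl_ge_diff\<close>, weighted by \<open>P\<close>, sum to
  the difference of the traces, which is zero.\<close>

lemma relative_entropy_nonneg:
  assumes A: "psd n A" and B: "psd n B" and tr: "mtrace A = mtrace B"
  shows "0 \<le> relative_entropy A B"
proof -
  obtain e r where er: "spectral n A e r" "\<And>k. k < n \<Longrightarrow> 0 \<le> r k"
    using psd_spectral[OF A] by blast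
  obtain f s where fs: "spectral n B f s" "\<And>k. k < n \<Longrightarrow> 0 \<le> s k"
    using psd_spectral[OF B] by blast
  note oe = spectral_orthonormal[OF er(1)] and of = spectral_orthonormal[OF fs(1)]
  define P where "P i j = (cmod (inner n (e i) (f j)))\<^sup>2" for i j
  have "(\<Sum>i<n. \<Sum>j<n. P i j * (r i - s j)) = (\<Sum>i<n. \<Sum>j<n. P i j * r i) - (\<Sum>i<n. \<Sum>j<n. P i j * s j)"
    by (simp add: right_diff_distrib sum_subtractf)
  also have "(\<Sum>i<n. \<Sum>j<n. P i j * s j) = (\<Sum>j<n. \<Sum>i<n. P i j * s j)"
    by (rule sum.swap)
  also have "\<dots> = (\<Sum>j<n. s j)"
    unfolding sum_distrib_right[symmetric]
    using orthonormal_sum_cmod_inner(2)[OF oe] orthonormal_inner[OF of] by (simp add: P_def)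
  also have "(\<Sum>i<n. \<Sum>j<n. P i j * r i) = (\<Sum>i<n. r i)"
    unfolding sum_distrib_right[symmetric]
    using orthonormal_sum_cmod_inner(1)[OF of] orthonormal_inner[OF oe] by (simp add: P_def)
  also have "(\<Sum>i<n. r i) - (\<Sum>j<n. s j) = 0"
    using tr unfolding mtrace_spectral[OF er(1)] mtrace_spectral[OF fs(1)] of_real_eq_iff by simp
  finally have "0 = (\<Sum>i<n. \<Sum>j<n. ereal (P i j * (r i - s j)))"
    by (simp add: zero_ereal_def)
  also have "\<dots> \<le> (\<Sum>i<n. \<Sum>j<n. ereal (P i j) * kl (r i) (s j))"
  proof (intro sum_mono)
    fix i j assume "i \<in> {..<n}" "j \<in> {..<n}"
    then have "ereal (P i j) * ereal (r i - s j) \<le> ereal (P i j) * kl (r i) (s j)"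
      using er(2) fs(2) by (intro ereal_mult_left_mono kl_ge_diff) (auto simp: P_def)
    then show "ereal (P i j * (r i - s j)) \<le> ereal (P i j) * kl (r i) (s j)"
      by simp
  qed
  also have "\<dots> = relative_entropy A B"
    unfolding P_def by (rule relative_entropy_spectral[OF er(1) fs(1), symmetric])
  finally show ?thesis .
qed

text \<open>The chi-square bounds add up to a term of first order in \<open>\<mu>\<close>, which is
  zero because \<open>D\<close> has trace zero, and one of second order. \<open>C\<close> is fixed
  before \<open>\<mu>\<close> and \<open>A\<close>, as the later limit in \<open>\<mu>\<close>
  requires.\<close>

lemma relative_entropy_perturbation_bound:
  assumes T: "psd n T" and D: "D \<in> carrier_mat n n" and tr: "mtrace D = 0"
  obtains C where "\<And>\<mu> A. 0 < \<mu> \<Longrightarrow> psd n A \<Longrightarrow> A = T + complex_of_real \<mu> \<cdot>\<^sub>m D \<Longrightarrow> supp A \<subseteq> supp T \<Longrightarrow>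
    relative_entropy A T \<le> ereal (C * \<mu>\<^sup>2)"
proof -
  obtain f s where fs: "spectral n T f s" "\<And>k. k < n \<Longrightarrow> 0 \<le> s k"
    using psd_spectral[OF T] by blast
  note of = spectral_orthonormal[OF fs(1)]
  define x where "x j = Re (inner n (app n D (f j)) (f j))" for j
  define y where "y j = (\<Sum>a<n. (cmod (app n D (f j) a))\<^sup>2)" for j
  have sum_x: "(\<Sum>j<n. x j) = 0"
    unfolding x_def using tr mtrace_orthonormal[OF D of] by (simp flip: Re_sum)
  \<comment> \<open>The trace of the adjoint of \<open>D\<close> times \<open>D\<close> times the
    inverse of \<open>T\<close> on its support.\<close>
  define C where "C = (\<Sum>j<n. if s j = 0 then 0 else y j / s j)"
  show ?thesis
  proof (rule that)
    fix \<mu> A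
    assume \<mu>: "0 < \<mu>" and A: "psd n A" and A_eq: "A = T + complex_of_real \<mu> \<cdot>\<^sub>m D" and supp: "supp A \<subseteq> supp T"
    obtain e r where er: "spectral n A e r" "\<And>k. k < n \<Longrightarrow> 0 \<le> r k"
      using psd_spectral[OF A] by blast
    note oe = spectral_orthonormal[OF er(1)]
    define P where "P i j = (cmod (inner n (e i) (f j)))\<^sup>2" for i j
    have Af: "app n A (f j) a = complex_of_real (s j) * f j a + complex_of_real \<mu> * app n D (f j) a"
      if "j < n" "a < n" for j a
      using that D psd_carrier[OF T] spectral_eigen[OF fs(1)] by (simp add: A_eq app_add app_smult)
    \<comment> \<open>First moment of the eigenvalues of \<open>A\<close> under the weights
      \<open>P i j\<close>: the diagonal entry of \<open>A\<close> at \<open>f j\<close>.\<close>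
    have Pr: "(\<Sum>i<n. P i j * r i) = s j + \<mu> * x j" if j: "j < n" for j
    proof -
      have "(\<Sum>i<n. P i j * r i) = Re (inner n (app n A (f j)) (f j))"
        unfolding spectral_quadratic_form[OF er(1)] P_def cmod_inner_commute[of n _ "f j"]
        by (simp add: mult.commute del: of_real_sum of_real_mult of_real_power)
      also have "inner n (app n A (f j)) (f j) = s j + \<mu> * inner n (app n D (f j)) (f j)"
        using j orthonormal_inner[OF of j j]
        by (simp add: Af inner_add_left inner_scale_left cong: inner_cong)
      finally show ?thesis
        by (simp add: x_def)
    qed
    \<comment> \<open>Second moment: the squared norm of \<open>A\<close> applied to
      \<open>f j\<close>, by Parseval in the eigenbasis of \<open>A\<close>. The two mixed terms are
      conjugate and add up to twice a real part.\<close>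
    have Prr: "(\<Sum>i<n. P i j * (r i)\<^sup>2) = (s j)\<^sup>2 + 2 * \<mu> * s j * x j + \<mu>\<^sup>2 * y j" if j: "j < n" for j
    proof -
      have "(\<Sum>i<n. P i j * (r i)\<^sup>2) = (\<Sum>i<n. (cmod (inner n (app n A (f j)) (e i)))\<^sup>2)"
        by (intro sum.cong refl)
          (simp add: spectral_inner_app[OF er(1)] P_def norm_mult power_mult_distrib cmod_inner_commute[of n _ "f j"])
      also have "\<dots> = Re (inner n (app n A (f j)) (app n A (f j)))"
        by (simp add: inner_self orthonormal_parseval_norm[OF oe, of "app n A (f j)"])
      also have "inner n (app n A (f j)) (app n A (f j)) =
          inner n (\<lambda>a. complex_of_real (s j) * f j a + complex_of_real \<mu> * app n D (f j) a)
            (\<lambda>a. complex_of_real (s j) * f j a + complex_of_real \<mu> * app n D (f j) a)"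
        using j by (intro inner_cong) (simp_all add: Af)
      also have "\<dots> = s j * s j * inner n (f j) (f j) + s j * \<mu> * inner n (f j) (app n D (f j))
          + s j * \<mu> * inner n (app n D (f j)) (f j) + \<mu> * \<mu> * inner n (app n D (f j)) (app n D (f j))"
        by (simp add: inner_add_left inner_add_right inner_scale_left inner_scale_right algebra_simps)
      also have "inner n (app n D (f j)) (app n D (f j)) = complex_of_real (y j)"
        by (simp add: y_def inner_self)
      also have "inner n (f j) (f j) = 1"
        using orthonormal_inner[OF of j j] by simp
      also have "inner n (f j) (app n D (f j)) = cnj (inner n (app n D (f j)) (f j))"
        by (rule inner_commute)
      finally show ?thesis
        by (simp add: x_def power2_eq_square)
    qed
    \<comment> \<open>Outside the support of \<open>T\<close> the diagonal entries of
      \<open>A\<close> vanish, hence so do the first-order coefficients. Restricting the sum to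
      \<open>s j \<noteq> 0\<close> therefore loses no first-order term.\<close>
    have x0: "x j = 0" if "j < n" "s j = 0" for j
    proof -
      have "P i j * r i = 0" if "i < n" for i
        using supp \<open>j < n\<close> \<open>s j = 0\<close> that unfolding supp_subset_spectral[OF er(1) fs(1)] by (auto simp: P_def)
      then have "(\<Sum>i<n. P i j * r i) = 0"
        by (intro sum.neutral) auto
      then show ?thesis
        using Pr[OF \<open>j < n\<close>] \<open>s j = 0\<close> \<mu> by simp
    qed
    have "relative_entropy A T = (\<Sum>i<n. \<Sum>j<n. ereal (P i j) * kl (r i) (s j))"
      unfolding P_def by (rule relative_entropy_spectral[OF er(1) fs(1)])
    also have "\<dots> \<le> (\<Sum>i<n. \<Sum>j<n. ereal (if s j = 0 then 0 else P i j * ((r i)\<^sup>2 / s j - r i)))"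
    proof (intro sum_mono)
      fix i j assume "i \<in> {..<n}" "j \<in> {..<n}"
      then have ij: "i < n" "j < n" by auto
      show "ereal (P i j) * kl (r i) (s j) \<le> ereal (if s j = 0 then 0 else P i j * ((r i)\<^sup>2 / s j - r i))"
      proof (cases "s j = 0")
        case True
        then have "ereal (P i j) * kl (r i) (s j) = ereal (if s j = 0 then 0 else P i j * ((r i)\<^sup>2 / s j - r i))"
          using supp ij unfolding supp_subset_spectral[OF er(1) fs(1)]
          by (cases "r i = 0") (auto simp: P_def kl_def simp flip: zero_ereal_def)
        then show ?thesis
          by (rule order.eq_iff[THEN iffD1, THEN conjunct1])
      next
        case False
        then have "ereal (P i j) * kl (r i) (s j) \<le> ereal (P i j) * ereal ((r i)\<^sup>2 / s j - r i)"
          using ij er(2) fs(2)[of j] by (intro ereal_mult_left_mono kl_le_chi_square) (auto simp: P_def)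
        then show ?thesis
          using False by simp
      qed
    qed
    also have "\<dots> = ereal (\<Sum>j<n. \<Sum>i<n. if s j = 0 then 0 else P i j * ((r i)\<^sup>2 / s j - r i))"
      by (subst sum.swap) simp
    also have "(\<Sum>j<n. \<Sum>i<n. if s j = 0 then 0 else P i j * ((r i)\<^sup>2 / s j - r i)) =
        (\<Sum>j<n. \<mu> * x j + \<mu>\<^sup>2 * (if s j = 0 then 0 else y j / s j))"
    proof (intro sum.cong refl)
      fix j assume "j \<in> {..<n}"
      then have j: "j < n" by simp
      show "(\<Sum>i<n. if s j = 0 then 0 else P i j * ((r i)\<^sup>2 / s j - r i)) =
          \<mu> * x j + \<mu>\<^sup>2 * (if s j = 0 then 0 else y j / s j)"
      proof (cases "s j = 0")
        case False
        have "(\<Sum>i<n. P i j * ((r i)\<^sup>2 / s j - r i)) = (\<Sum>i<n. P i j * (r i)\<^sup>2) / s j - (\<Sum>i<n. P i j * r i)"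
          by (simp add: right_diff_distrib sum_subtractf sum_divide_distrib)
        \<comment> \<open>Dividing the second moment by \<open>s j\<close> and subtracting the first
          cancels \<open>s j\<close> and one of the two mixed terms.\<close>
        then show ?thesis
          using False unfolding Pr[OF j] Prr[OF j] by (simp add: field_simps power2_eq_square)
      qed (use x0[OF j] in simp)
    qed
    also have "\<dots> = C * \<mu>\<^sup>2"
      using sum_x by (simp add: sum.distrib C_def mult.commute flip: sum_distrib_left)
    finally show "relative_entropy A T \<le> ereal (C * \<mu>\<^sup>2)" .
  qed
qed

section \<open>Classical-quantum states and channels\<close>

lemma sum_lessThan_mult:
  fixes F :: "nat \<Rightarrow> 'a::comm_monoid_add"
  shows "(\<Sum>k<n * d. F k) = (\<Sum>u<n. \<Sum>i<d. F (u * d + i))"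
proof -
  have "(\<Sum>k<n * d. F k) = (\<Sum>u<n. sum F {u * d..<u * d + d})"
    by (rule sum.nat_group[symmetric])
  also have "\<dots> = (\<Sum>u<n. \<Sum>i<d. F (u * d + i))"
  proof (rule sum.cong[OF refl])
    fix u
    show "sum F {u * d..<u * d + d} = (\<Sum>i<d. F (u * d + i))"
      using sum.shift_bounds_nat_ivl[of F 0 "u * d" d] by (simp add: add.commute atLeast0LessThan)
  qed
  finally show ?thesis .
qed

lemma sum_lessThan_mult_div_mod:
  fixes F :: "nat \<Rightarrow> nat \<Rightarrow> 'a::comm_monoid_add"
  shows "(\<Sum>k<n * d. F (k div d) (k mod d)) = (\<Sum>u<n. \<Sum>i<d. F u i)"
  unfolding sum_lessThan_mult by (rule sum.cong[OF refl], rule sum.cong[OF refl]) simp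

lemma div_less_mod_less:
  fixes k n d :: nat
  assumes "k < n * d"
  shows "k div d < n" "k mod d < d"
proof -
  have "0 < d"
    using assms by (cases d) auto
  then show "k div d < n" "k mod d < d"
    using assms by (simp_all add: less_mult_imp_div_less)
qed

lemma index_in_block:
  fixes q r k a :: nat
  assumes "q < k" "r < a"
  shows "q * a + r < k * a"
proof -
  have "q * a + r < Suc q * a"
    using assms by simp
  also have "\<dots> \<le> k * a"
    using assms by (intro mult_right_mono) auto
  finally show ?thesis .
qed

lemma inner_tensor:
  "inner (n * d) (\<lambda>a. x (a div d) * y (a mod d)) (\<lambda>a. x' (a div d) * y' (a mod d)) = inner n x x' * inner d y y'"
proof -
  have "inner (n * d) (\<lambda>a. x (a div d) * y (a mod d)) (\<lambda>a. x' (a div d) * y' (a mod d)) =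
      (\<Sum>u<n. \<Sum>i<d. x u * y i * (cnj (x' u) * cnj (y' i)))"
    unfolding inner_def complex_cnj_mult
    by (rule sum_lessThan_mult_div_mod[of "\<lambda>u i. x u * y i * (cnj (x' u) * cnj (y' i))"])
  then show ?thesis
    by (simp add: inner_def sum_product mult_ac)
qed

text \<open>The eigenvectors are the products of \<open>E u\<close> with \<open>f u i\<close>,
  listed by \<open>k = u * d + i\<close>. Used for a classical-quantum state and, with constant
  \<open>T\<close>, for the product of its marginals.\<close>

lemma spectral_block:
  assumes E: "orthonormal n n E" and T: "\<And>u. u < n \<Longrightarrow> spectral d (T u) (f u) (t u)"
  shows "spectral (n * d)
    (mat (n * d) (n * d) (\<lambda>(i, j). \<Sum>u<n. complex_of_real (p u) * (E u (i div d) * cnj (E u (j div d))) * T u $$ (i mod d, j mod d)))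
    (\<lambda>k a. E (k div d) (a div d) * f (k div d) (k mod d) (a mod d)) (\<lambda>k. p (k div d) * t (k div d) (k mod d))"
  unfolding spectral_def
proof (intro conjI allI impI)
  show "orthonormal (n * d) (n * d) (\<lambda>k a. E (k div d) (a div d) * f (k div d) (k mod d) (a mod d))"
    unfolding orthonormal_def inner_tensor
  proof (intro allI impI)
    fix k l assume kl: "k < n * d" "l < n * d"
    have "k = l \<longleftrightarrow> k div d = l div d \<and> k mod d = l mod d"
      by (metis div_mult_mod_eq)
    then show "inner n (E (k div d)) (E (l div d)) * inner d (f (k div d) (k mod d)) (f (l div d) (l mod d)) = (if k = l then 1 else 0)"
      using orthonormal_inner[OF E] orthonormal_inner[OF spectral_orthonormal[OF T]] div_less_mod_less[OF kl(1)] div_less_mod_less[OF kl(2)]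
      by auto
  qed
  fix a b assume "a < n * d" "b < n * d"
  note ab = this div_less_mod_less[OF this(1)] div_less_mod_less[OF this(2)]
  have "(\<Sum>k<n * d. complex_of_real (p (k div d) * t (k div d) (k mod d)) * (E (k div d) (a div d) * f (k div d) (k mod d) (a mod d))
        * cnj (E (k div d) (b div d) * f (k div d) (k mod d) (b mod d))) =
      (\<Sum>u<n. \<Sum>i<d. complex_of_real (p u * t u i) * (E u (a div d) * f u i (a mod d)) * cnj (E u (b div d) * f u i (b mod d)))"
    by (rule sum_lessThan_mult_div_mod)
  also have "\<dots> = (\<Sum>u<n. complex_of_real (p u) * (E u (a div d) * cnj (E u (b div d))) * T u $$ (a mod d, b mod d))"
    using T ab by (simp add: spectral_def sum_distrib_left mult_ac)
  finally show "mat (n * d) (n * d) (\<lambda>(i, j). \<Sum>u<n. complex_of_real (p u) * (E u (i div d) * cnj (E u (j div d))) * T u $$ (i mod d, j mod d)) $$ (a, b) =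
      (\<Sum>k<n * d. complex_of_real (p (k div d) * t (k div d) (k mod d)) * (E (k div d) (a div d) * f (k div d) (k mod d) (a mod d))
        * cnj (E (k div d) (b div d) * f (k div d) (k mod d) (b mod d)))"
    using ab by simp
qed auto

section \<open>Mutual information of classical-quantum states\<close>

lemma orthonormal_basis_orthonormal: "orthonormal_basis n e \<Longrightarrow> orthonormal n n (\<lambda>u. ($) (e u))"
  by (simp add: orthonormal_basis_def orthonormal_def flip: cscalar_prod_eq_inner)

text \<open>A common factor cancels inside the logarithm; for \<open>p = 0\<close> both sides vanish
  because zero times infinity is zero.\<close>

lemma kl_scale: "0 \<le> p \<Longrightarrow> 0 \<le> r \<Longrightarrow> 0 \<le> s \<Longrightarrow> kl (p * r) (p * s) = ereal p * kl r s"
  by (auto simp: kl_def ln_mult zero_ereal_def[symmetric])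

lemma ereal_sum_distrib_left:
  fixes F :: "'a \<Rightarrow> ereal"
  assumes "0 \<le> c"
  shows "(\<Sum>i\<in>I. ereal c * F i) = ereal c * (\<Sum>i\<in>I. F i)"
  using assms by (induction I rule: infinite_finite_induct) (simp_all add: ereal_pos_distrib)

text \<open>The quantum marginal of \<open>cq_state\<close>, written entrywise so that it is an
  instance of \<open>ampliation_sum\<close>.\<close>

definition mixture :: "nat \<Rightarrow> nat \<Rightarrow> (nat \<Rightarrow> real) \<Rightarrow> (nat \<Rightarrow> complex mat) \<Rightarrow> complex mat" where
  "mixture n d p \<rho>s = mat d d (\<lambda>ij. \<Sum>u<n. complex_of_real (p u) * \<rho>s u $$ ij)"

lemma density_psd: "density_operator d \<rho> \<Longrightarrow> psd d \<rho>"
  by (simp add: density_operator_def)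

lemma cq_state_eq:
  assumes e: "orthonormal_basis n e" and \<rho>s: "\<And>u. u < n \<Longrightarrow> \<rho>s u \<in> carrier_mat d d"
  shows "cq_state n d e p \<rho>s = mat (n * d) (n * d) (\<lambda>(i, j). \<Sum>u<n. complex_of_real (p u) *
    (e u $ (i div d) * cnj (e u $ (j div d))) * \<rho>s u $$ (i mod d, j mod d))"
proof (rule eq_matI; clarsimp simp: cq_state_def)
  fix i j assume ij: "i < n * d" "j < n * d"
  show "(\<Sum>u<n. (complex_of_real (p u) \<cdot>\<^sub>m tensor_mat (ketbra (e u) (e u)) (\<rho>s u)) $$ (i, j)) =
    (\<Sum>u<n. complex_of_real (p u) * (e u $ (i div d) * cnj (e u $ (j div d))) * \<rho>s u $$ (i mod d, j mod d))"
  proof (intro sum.cong refl)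
    fix u assume "u \<in> {..<n}"
    then have "dim_vec (e u) = n" "dim_row (\<rho>s u) = d" "dim_col (\<rho>s u) = d"
      using e \<rho>s[of u] by (auto simp: orthonormal_basis_def)
    then show "(complex_of_real (p u) \<cdot>\<^sub>m tensor_mat (ketbra (e u) (e u)) (\<rho>s u)) $$ (i, j) =
        complex_of_real (p u) * (e u $ (i div d) * cnj (e u $ (j div d))) * \<rho>s u $$ (i mod d, j mod d)"
      using ij div_less_mod_less[OF ij(1)] div_less_mod_less[OF ij(2)]
      by (simp add: tensor_mat_def ketbra_def)
  qed
qed

lemma ptrace_fst_cq_state:
  assumes e: "orthonormal_basis n e" and \<rho>s: "\<And>u. u < n \<Longrightarrow> \<rho>s u \<in> carrier_mat d d"
  shows "ptrace_fst n d (cq_state n d e p \<rho>s) = mixture n d p \<rho>s"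
proof (rule eq_matI; clarsimp simp: ptrace_fst_def mixture_def)
  fix i j assume ij: "i < d" "j < d"
  have "(\<Sum>k<n. cq_state n d e p \<rho>s $$ (k * d + i, k * d + j)) =
      (\<Sum>k<n. \<Sum>u<n. complex_of_real (p u) * (e u $ k * cnj (e u $ k)) * \<rho>s u $$ (i, j))"
    using ij index_in_block by (simp add: cq_state_eq[OF e, of \<rho>s d p, OF \<rho>s])
  also have "\<dots> = (\<Sum>u<n. \<Sum>k<n. complex_of_real (p u) * (e u $ k * cnj (e u $ k)) * \<rho>s u $$ (i, j))"
    by (rule sum.swap)
  also have "\<dots> = (\<Sum>u<n. complex_of_real (p u) * inner n (($) (e u)) (($) (e u)) * \<rho>s u $$ (i, j))"
    by (simp add: inner_def sum_distrib_left sum_distrib_right)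
  also have "\<dots> = (\<Sum>u<n. complex_of_real (p u) * \<rho>s u $$ (i, j))"
    using orthonormal_inner[OF orthonormal_basis_orthonormal[OF e]] by simp
  finally show "(\<Sum>k<n. cq_state n d e p \<rho>s $$ (k * d + i, k * d + j)) = (\<Sum>u<n. complex_of_real (p u) * \<rho>s u $$ (i, j))" .
qed

lemma ptrace_snd_cq_state:
  assumes e: "orthonormal_basis n e" and \<rho>s: "\<And>u. u < n \<Longrightarrow> \<rho>s u \<in> carrier_mat d d \<and> mtrace (\<rho>s u) = 1"
    and ij: "i < n" "j < n"
  shows "ptrace_snd n d (cq_state n d e p \<rho>s) $$ (i, j) = (\<Sum>u<n. complex_of_real (p u) * (e u $ i * cnj (e u $ j)))"
proof -
  have "ptrace_snd n d (cq_state n d e p \<rho>s) $$ (i, j) = (\<Sum>k<d. \<Sum>u<n. complex_of_real (p u) * (e u $ i * cnj (e u $ j)) * \<rho>s u $$ (k, k))"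
    using ij index_in_block \<rho>s by (simp add: ptrace_snd_def cq_state_eq[OF e])
  also have "\<dots> = (\<Sum>u<n. complex_of_real (p u) * (e u $ i * cnj (e u $ j)) * (\<Sum>k<d. \<rho>s u $$ (k, k)))"
    unfolding sum_distrib_left by (rule sum.swap)
  also have "\<dots> = (\<Sum>u<n. complex_of_real (p u) * (e u $ i * cnj (e u $ j)))"
    using \<rho>s by (intro sum.cong refl) (force simp: mtrace_def)
  finally show ?thesis .
qed

lemma inner_app_mixture:
  assumes "\<And>u. u < n \<Longrightarrow> \<rho>s u \<in> carrier_mat d d"
  shows "inner d (app d (mixture n d p \<rho>s) v) w = (\<Sum>u<n. complex_of_real (p u) * inner d (app d (\<rho>s u) v) w)"
proof -
  have "inner d (app d (mixture n d p \<rho>s) v) w =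
      (\<Sum>a<d. \<Sum>b<d. \<Sum>u<n. complex_of_real (p u) * (\<rho>s u $$ (a, b) * v b * cnj (w a)))"
    by (simp add: inner_app_eq mixture_def sum_distrib_right mult.assoc)
  also have "\<dots> = (\<Sum>a<d. \<Sum>u<n. \<Sum>b<d. complex_of_real (p u) * (\<rho>s u $$ (a, b) * v b * cnj (w a)))"
    by (intro sum.cong refl sum.swap)
  also have "\<dots> = (\<Sum>u<n. \<Sum>a<d. \<Sum>b<d. complex_of_real (p u) * (\<rho>s u $$ (a, b) * v b * cnj (w a)))"
    by (rule sum.swap)
  finally show ?thesis
    by (simp add: inner_app_eq sum_distrib_left)
qed

lemma psd_mixture:
  assumes "\<And>u. u < n \<Longrightarrow> 0 \<le> p u \<and> psd d (\<rho>s u)"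
  shows "psd d (mixture n d p \<rho>s)"
  unfolding psd_iff
proof (intro conjI allI)
  fix v
  have "inner d (app d (mixture n d p \<rho>s) v) v = (\<Sum>u<n. complex_of_real (p u) * inner d (app d (\<rho>s u) v) v)"
    using assms by (intro inner_app_mixture) (simp add: psd_carrier)
  also have "0 \<le> \<dots>"
    using assms by (intro sum_nonneg mult_nonneg_nonneg) (auto simp: psd_iff less_eq_complex_def)
  finally show "0 \<le> inner d (app d (mixture n d p \<rho>s) v) v" .
qed (simp add: mixture_def)

text \<open>The state and the product of its marginals are block diagonal in the same basis
  \<open>E\<close>, with blocks \<open>\<rho>s u\<close> and \<open>\<tau>\<close> both weighted by
  \<open>p u\<close>. Distinct blocks do not overlap, and inside a block the weight comes out by
  \<open>kl_scale\<close>.\<close>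

lemma mutual_information_cq_state:
  assumes ens: "cq_ensemble n d e p \<rho>s"
  shows "mutual_information n d (cq_state n d e p \<rho>s) =
    (\<Sum>u<n. ereal (p u) * relative_entropy (\<rho>s u) (mixture n d p \<rho>s))"
proof -
  have e: "orthonormal_basis n e" and p: "\<And>u. u < n \<Longrightarrow> 0 \<le> p u" and dens: "\<And>u. u < n \<Longrightarrow> density_operator d (\<rho>s u)"
    using ens by (auto simp: cq_ensemble_def prob_dist_def)
  have carr: "\<rho>s u \<in> carrier_mat d d" if "u < n" for u
    using dens[OF that] by (simp add: density_psd psd_carrier)
  define \<tau> where "\<tau> = mixture n d p \<rho>s"
  have "psd d \<tau>"
    unfolding \<tau>_def using p dens by (intro psd_mixture) (simp add: density_psd)
  then obtain f s where fs: "spectral d \<tau> f s" "\<And>j. j < d \<Longrightarrow> 0 \<le> s j"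
    using psd_spectral by blast
  have "\<exists>g t. spectral d (\<rho>s u) g t \<and> (\<forall>i<d. 0 \<le> t i)" if "u < n" for u
    using psd_spectral[OF density_psd[OF dens[OF that]]] by metis
  then obtain g t where gt: "\<And>u. u < n \<Longrightarrow> spectral d (\<rho>s u) (g u) (t u)" "\<And>u i. u < n \<Longrightarrow> i < d \<Longrightarrow> 0 \<le> t u i"
    by metis
  define E where "E u = ($) (e u)" for u
  have E: "orthonormal n n E"
    using orthonormal_basis_orthonormal[OF e] unfolding E_def .
  have X_eq: "cq_state n d e p \<rho>s = mat (n * d) (n * d) (\<lambda>(i, j). \<Sum>u<n. complex_of_real (p u) *
      (E u (i div d) * cnj (E u (j div d))) * \<rho>s u $$ (i mod d, j mod d))"
    unfolding E_def by (rule cq_state_eq[OF e carr])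
  have X: "spectral (n * d) (cq_state n d e p \<rho>s)
      (\<lambda>k a. E (k div d) (a div d) * g (k div d) (k mod d) (a mod d)) (\<lambda>k. p (k div d) * t (k div d) (k mod d))"
    unfolding X_eq by (rule spectral_block[OF E gt(1)])
  \<comment> \<open>The product of the marginals has the form required by
    \<open>spectral_block\<close>, with the same block \<open>\<tau>\<close> for every
    \<open>u\<close>.\<close>
  have "tensor_mat (ptrace_snd n d (cq_state n d e p \<rho>s)) (ptrace_fst n d (cq_state n d e p \<rho>s)) =
      mat (n * d) (n * d) (\<lambda>(i, j). \<Sum>u<n. complex_of_real (p u) * (E u (i div d) * cnj (E u (j div d))) * \<tau> $$ (i mod d, j mod d))"
  proof (rule eq_matI)
    fix i j assume "i < dim_row (mat (n * d) (n * d) (\<lambda>(i, j). \<Sum>u<n. complex_of_real (p u) * (E u (i div d) * cnj (E u (j div d))) * \<tau> $$ (i mod d, j mod d)))"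
      "j < dim_col (mat (n * d) (n * d) (\<lambda>(i, j). \<Sum>u<n. complex_of_real (p u) * (E u (i div d) * cnj (E u (j div d))) * \<tau> $$ (i mod d, j mod d)))"
    then have ij: "i < n * d" "j < n * d"
      by auto
    have "ptrace_snd n d (cq_state n d e p \<rho>s) $$ (i div d, j div d) =
        (\<Sum>u<n. complex_of_real (p u) * (e u $ (i div d) * cnj (e u $ (j div d))))"
      using carr dens ij by (intro ptrace_snd_cq_state[OF e]) (auto simp: density_operator_def div_less_mod_less)
    moreover have "dim_row (mixture n d p \<rho>s) = d" "dim_col (mixture n d p \<rho>s) = d"
      by (simp_all add: mixture_def)
    moreover have "dim_row (ptrace_snd n d Y) = n" "dim_col (ptrace_snd n d Y) = n"
      "dim_row (ptrace_fst n d Y) = d" "dim_col (ptrace_fst n d Y) = d" for Y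
      by (simp_all add: ptrace_snd_def ptrace_fst_def)
    ultimately show "tensor_mat (ptrace_snd n d (cq_state n d e p \<rho>s)) (ptrace_fst n d (cq_state n d e p \<rho>s)) $$ (i, j) =
      mat (n * d) (n * d) (\<lambda>(i, j). \<Sum>u<n. complex_of_real (p u) * (E u (i div d) * cnj (E u (j div d))) * \<tau> $$ (i mod d, j mod d)) $$ (i, j)"
      using ij carr by (simp add: tensor_mat_def ptrace_fst_cq_state[OF e] \<tau>_def E_def sum_distrib_right)
  qed (simp_all add: tensor_mat_def ptrace_snd_def ptrace_fst_def)
  then have Y: "spectral (n * d) (tensor_mat (ptrace_snd n d (cq_state n d e p \<rho>s)) (ptrace_fst n d (cq_state n d e p \<rho>s)))
      (\<lambda>k a. E (k div d) (a div d) * f (k mod d) (a mod d)) (\<lambda>k. p (k div d) * s (k mod d))"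
    by (simp only:) (rule spectral_block[OF E fs(1)])
  have "mutual_information n d (cq_state n d e p \<rho>s) =
      (\<Sum>k<n * d. \<Sum>l<n * d. ereal ((cmod (inner n (E (k div d)) (E (l div d)) * inner d (g (k div d) (k mod d)) (f (l mod d))))\<^sup>2)
        * kl (p (k div d) * t (k div d) (k mod d)) (p (l div d) * s (l mod d)))"
    unfolding mutual_information_def relative_entropy_spectral[OF X Y] inner_tensor ..
  also have "\<dots> = (\<Sum>u<n. \<Sum>i<d. \<Sum>l<n * d. ereal ((cmod (inner n (E u) (E (l div d)) * inner d (g u i) (f (l mod d))))\<^sup>2)
        * kl (p u * t u i) (p (l div d) * s (l mod d)))"
    by (rule sum_lessThan_mult_div_mod)
  also have "\<dots> = (\<Sum>u<n. \<Sum>i<d. \<Sum>v<n. \<Sum>j<d. ereal ((cmod (inner n (E u) (E v) * inner d (g u i) (f j)))\<^sup>2)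
        * kl (p u * t u i) (p v * s j))"
    by (rule sum.cong[OF refl], rule sum.cong[OF refl], rule sum_lessThan_mult_div_mod)
  also have "\<dots> = (\<Sum>u<n. \<Sum>i<d. \<Sum>v<n. if u = v then \<Sum>j<d. ereal (p u) * (ereal ((cmod (inner d (g u i) (f j)))\<^sup>2)
        * kl (t u i) (s j)) else 0)"
  proof (intro sum.cong refl)
    fix u i v assume "u \<in> {..<n}" "i \<in> {..<d}" "v \<in> {..<n}"
    then show "(\<Sum>j<d. ereal ((cmod (inner n (E u) (E v) * inner d (g u i) (f j)))\<^sup>2) * kl (p u * t u i) (p v * s j)) =
        (if u = v then \<Sum>j<d. ereal (p u) * (ereal ((cmod (inner d (g u i) (f j)))\<^sup>2) * kl (t u i) (s j)) else 0)"
      using orthonormal_inner[OF E] p gt(2) fs(2) by (auto simp: kl_scale mult_ac zero_ereal_def[symmetric] intro!: sum.cong)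
  qed
  also have "\<dots> = (\<Sum>u<n. ereal (p u) * (\<Sum>i<d. \<Sum>j<d. ereal ((cmod (inner d (g u i) (f j)))\<^sup>2) * kl (t u i) (s j)))"
    using p by (simp add: ereal_sum_distrib_left)
  also have "\<dots> = (\<Sum>u<n. ereal (p u) * relative_entropy (\<rho>s u) \<tau>)"
    by (intro sum.cong refl) (simp add: relative_entropy_spectral[OF gt(1) fs(1)])
  finally show ?thesis
    unfolding \<tau>_def .
qed

section \<open>Channels acting on one factor\<close>

lemma channel_carrier: "quantum_channel a b M \<Longrightarrow> X \<in> carrier_mat a a \<Longrightarrow> M X \<in> carrier_mat b b"
  by (simp add: quantum_channel_def)

text \<open>Additivity and homogeneity, iterated. The empty sum needs that \<open>M\<close> maps
  zero to zero, which is homogeneity with factor zero.\<close>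

lemma channel_sum:
  fixes n :: nat
  assumes M: "quantum_channel a b M" and Y: "\<And>u. u < n \<Longrightarrow> Y u \<in> carrier_mat a a"
  shows "M (mat a a (\<lambda>ij. \<Sum>u<n. c u * Y u $$ ij)) = mat b b (\<lambda>ij. \<Sum>u<n. c u * M (Y u) $$ ij)"
  using Y
proof (induction n)
  case 0
  have "M (0 \<cdot>\<^sub>m 0\<^sub>m a a) = 0 \<cdot>\<^sub>m M (0\<^sub>m a a)"
    using M zero_carrier_mat unfolding quantum_channel_def by blast
  moreover have "0 \<cdot>\<^sub>m 0\<^sub>m a a = (0\<^sub>m a a :: complex mat)"
    by (intro eq_matI) auto
  moreover have "0 \<cdot>\<^sub>m M (0\<^sub>m a a) = 0\<^sub>m b b"
    using channel_carrier[OF M zero_carrier_mat] by (intro eq_matI) auto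
  moreover have "mat k k (\<lambda>ij. \<Sum>u<(0::nat). F u ij) = 0\<^sub>m k k" for k and F :: "nat \<Rightarrow> nat \<times> nat \<Rightarrow> complex"
    by (intro eq_matI) auto
  ultimately show ?case
    by simp
next
  case (Suc n)
  let ?Z = "mat a a (\<lambda>ij. \<Sum>u<n. c u * Y u $$ ij)"
  have step: "mat k k (\<lambda>ij. \<Sum>u<Suc n. c u * W u $$ ij) = mat k k (\<lambda>ij. \<Sum>u<n. c u * W u $$ ij) + c n \<cdot>\<^sub>m W n"
    if "W n \<in> carrier_mat k k" for k and W :: "nat \<Rightarrow> complex mat"
    using that by (intro eq_matI) auto
  have "M (mat a a (\<lambda>ij. \<Sum>u<Suc n. c u * Y u $$ ij)) = M (?Z + c n \<cdot>\<^sub>m Y n)"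
    using step[of Y] Suc.prems by simp
  also have "\<dots> = M ?Z + c n \<cdot>\<^sub>m M (Y n)"
    using M Suc.prems[of n] by (simp add: quantum_channel_def)
  also have "M ?Z = mat b b (\<lambda>ij. \<Sum>u<n. c u * M (Y u) $$ ij)"
    using Suc by simp
  finally show ?case
    using step[of "\<lambda>u. M (Y u)"] channel_carrier[OF M] Suc.prems by simp
qed

lemma ampliation_carrier: "ampliation k a b M X \<in> carrier_mat (k * b) (k * b)"
  by (simp add: ampliation_def)

lemma ampliation_sum:
  fixes n :: nat
  assumes M: "quantum_channel a b M" and Y: "\<And>u. u < n \<Longrightarrow> Y u \<in> carrier_mat (k * a) (k * a)"
  shows "ampliation k a b M (mat (k * a) (k * a) (\<lambda>ij. \<Sum>u<n. c u * Y u $$ ij)) =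
    mat (k * b) (k * b) (\<lambda>ij. \<Sum>u<n. c u * ampliation k a b M (Y u) $$ ij)"
proof (rule eq_matI)
  fix i j
  assume "i < dim_row (mat (k * b) (k * b) (\<lambda>ij. \<Sum>u<n. c u * ampliation k a b M (Y u) $$ ij))"
    "j < dim_col (mat (k * b) (k * b) (\<lambda>ij. \<Sum>u<n. c u * ampliation k a b M (Y u) $$ ij))"
  then have "i < k * b" "j < k * b" by auto
  note ij = this div_less_mod_less[OF this(1)] div_less_mod_less[OF this(2)]
  let ?B = "\<lambda>X. mat a a (\<lambda>(r, s). X $$ ((i div b) * a + r, (j div b) * a + s))"
  have "?B (mat (k * a) (k * a) (\<lambda>ij. \<Sum>u<n. c u * Y u $$ ij)) = mat a a (\<lambda>ij. \<Sum>u<n. c u * ?B (Y u) $$ ij)"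
    using ij index_in_block by (intro eq_matI) auto
  then show "ampliation k a b M (mat (k * a) (k * a) (\<lambda>ij. \<Sum>u<n. c u * Y u $$ ij)) $$ (i, j) =
      mat (k * b) (k * b) (\<lambda>ij. \<Sum>u<n. c u * ampliation k a b M (Y u) $$ ij) $$ (i, j)"
    using ij channel_sum[OF M, of n "\<lambda>u. ?B (Y u)" c] by (simp add: ampliation_def)
qed (simp_all add: ampliation_def)

lemma ampliation_mixture:
  assumes "quantum_channel a b M" "\<And>u. u < n \<Longrightarrow> \<rho>s u \<in> carrier_mat (k * a) (k * a)"
  shows "ampliation k a b M (mixture n (k * a) p \<rho>s) = mixture n (k * b) p (\<lambda>u. ampliation k a b M (\<rho>s u))"
  unfolding mixture_def using assms by (rule ampliation_sum)

lemma ampliation_add_smult: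
  assumes M: "quantum_channel a b M" and X: "X \<in> carrier_mat (k * a) (k * a)" and Y: "Y \<in> carrier_mat (k * a) (k * a)"
  shows "ampliation k a b M (X + c \<cdot>\<^sub>m Y) = ampliation k a b M X + c \<cdot>\<^sub>m ampliation k a b M Y"
proof -
  define Z where "Z u = (if u = 0 then X else Y)" for u :: nat
  define d where "d u = (if u = 0 then 1 else c)" for u :: nat
  have "A + c \<cdot>\<^sub>m B = mat m m (\<lambda>ij. \<Sum>u<2. d u * (if u = 0 then A else B) $$ ij)"
    if "A \<in> carrier_mat m m" "B \<in> carrier_mat m m" for A B m
    using that by (intro eq_matI) (auto simp: d_def numeral_2_eq_2)
  from this[OF X Y] this[OF ampliation_carrier ampliation_carrier, of k a b M X a M Y]
  show ?thesis
    using ampliation_sum[OF M, of 2 Z k d] X Y by (simp add: Z_def if_distrib[of "ampliation k a b M"])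
qed

text \<open>Only the diagonal blocks enter the trace, and the channel preserves the trace of
  each.\<close>

lemma mtrace_ampliation:
  assumes M: "quantum_channel a b M" and X: "X \<in> carrier_mat (k * a) (k * a)"
  shows "mtrace (ampliation k a b M X) = mtrace X"
proof -
  let ?B = "\<lambda>q. mat a a (\<lambda>(r, s). X $$ (q * a + r, q * a + s))"
  have "mtrace (ampliation k a b M X) = (\<Sum>q<k. \<Sum>i<b. M (?B q) $$ (i, i))"
    by (simp add: mtrace_def ampliation_def sum_lessThan_mult_div_mod[of "\<lambda>q i. M (?B q) $$ (i, i)"])
  also have "\<dots> = (\<Sum>q<k. mtrace (M (?B q)))"
  proof (rule sum.cong[OF refl])
    fix q
    have "dim_row (M (?B q)) = b"
      using channel_carrier[OF M, of "?B q"] by auto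
    then show "(\<Sum>i<b. M (?B q) $$ (i, i)) = mtrace (M (?B q))"
      by (simp add: mtrace_def)
  qed
  also have "\<dots> = (\<Sum>q<k. mtrace (?B q))"
    using M by (simp add: quantum_channel_def)
  also have "\<dots> = mtrace X"
    using X by (simp add: mtrace_def sum_lessThan_mult[of _ k a])
  finally show ?thesis .
qed

lemma psd_ampliation: "quantum_channel a b M \<Longrightarrow> psd (k * a) X \<Longrightarrow> psd (k * b) (ampliation k a b M X)"
  by (simp add: quantum_channel_def)

lemma density_ampliation:
  "quantum_channel a b M \<Longrightarrow> density_operator (k * a) X \<Longrightarrow> density_operator (k * b) (ampliation k a b M X)"
  by (simp add: density_operator_def psd_ampliation mtrace_ampliation psd_carrier)

text \<open>Each block on which the channel acts is a linear combination of blocks of the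
  \<open>\<rho>s u\<close>, with coefficients given by the weights and the classical labels, so
  linearity of \<open>M\<close> suffices.\<close>

lemma ampliation_cq_state:
  assumes M: "quantum_channel a b M" and e: "orthonormal_basis n e"
    and \<rho>s: "\<And>u. u < n \<Longrightarrow> \<rho>s u \<in> carrier_mat (k * a) (k * a)"
  shows "ampliation (n * k) a b M (cq_state n (k * a) e p \<rho>s) = cq_state n (k * b) e p (\<lambda>u. ampliation k a b M (\<rho>s u))"
  unfolding cq_state_eq[OF e, of "\<lambda>u. ampliation k a b M (\<rho>s u)", OF ampliation_carrier]
proof (rule eq_matI)
  fix i j
  assume "i < dim_row (mat (n * (k * b)) (n * (k * b)) (\<lambda>(i, j). \<Sum>u<n. complex_of_real (p u) *
      (e u $ (i div (k * b)) * cnj (e u $ (j div (k * b)))) * ampliation k a b M (\<rho>s u) $$ (i mod (k * b), j mod (k * b))))"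
    "j < dim_col (mat (n * (k * b)) (n * (k * b)) (\<lambda>(i, j). \<Sum>u<n. complex_of_real (p u) *
      (e u $ (i div (k * b)) * cnj (e u $ (j div (k * b)))) * ampliation k a b M (\<rho>s u) $$ (i mod (k * b), j mod (k * b))))"
  then have "i < n * k * b" "j < n * k * b" by (auto simp: mult.assoc)
  note ij = this div_less_mod_less[OF this(1)] div_less_mod_less[OF this(2)]
  \<comment> \<open>For the fixed entry \<open>(i, j)\<close>, \<open>c u\<close> is the classical
    factor of summand \<open>u\<close>, and \<open>B u\<close> is the block of
    \<open>\<rho>s u\<close> at the labels of the reference system.\<close>
  define c where "c u = complex_of_real (p u) * (e u $ (i div (k * b)) * cnj (e u $ (j div (k * b))))" for u
  define B where "B u = mat a a (\<lambda>(r, s). \<rho>s u $$ ((i div b) mod k * a + r, (j div b) mod k * a + s))" for u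
  \<comment> \<open>A block index \<open>x\<close> combines the classical label
    \<open>x div k\<close> with the reference label \<open>x mod k\<close>; this regroups the three
    factors.\<close>
  have idx: "(x * a + r) div (k * a) = x div k" "(x * a + r) mod (k * a) = x mod k * a + r" if "r < a" for x r
    using that by (simp_all add: div_mult2_eq mod_mult2_eq mult.commute[of k a])
  have idx': "x div (k * b) = x div b div k" "x mod (k * b) div b = x div b mod k" "x mod (k * b) mod b = x mod b" if "x < n * k * b" for x
    using div_less_mod_less[OF that] by (simp_all add: div_mult2_eq mod_mult2_eq mult.commute[of k b])
  have lt: "x * a + r < n * (k * a)" if "x < n * k" "r < a" for x r
    using index_in_block[OF that] by (simp add: mult.assoc)
  have "ampliation (n * k) a b M (cq_state n (k * a) e p \<rho>s) $$ (i, j) =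
      M (mat a a (\<lambda>(r, s). cq_state n (k * a) e p \<rho>s $$ ((i div b) * a + r, (j div b) * a + s))) $$ (i mod b, j mod b)"
    using ij by (simp add: ampliation_def)
  also have "mat a a (\<lambda>(r, s). cq_state n (k * a) e p \<rho>s $$ ((i div b) * a + r, (j div b) * a + s)) =
      mat a a (\<lambda>rs. \<Sum>u<n. c u * B u $$ rs)"
    using ij \<rho>s lt idx' by (intro eq_matI) (auto simp: cq_state_eq[OF e, of \<rho>s "k * a" p, OF \<rho>s] idx B_def c_def)
  also have "M \<dots> = mat b b (\<lambda>rs. \<Sum>u<n. c u * M (B u) $$ rs)"
    by (rule channel_sum[OF M]) (simp add: B_def)
  also have "\<dots> $$ (i mod b, j mod b) = (\<Sum>u<n. c u * M (B u) $$ (i mod b, j mod b))"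
    using ij by simp
  also have "\<dots> = (\<Sum>u<n. c u * ampliation k a b M (\<rho>s u) $$ (i mod (k * b), j mod (k * b)))"
  proof (intro sum.cong refl)
    fix u
    have "i mod (k * b) < k * b" "j mod (k * b) < k * b"
      using ij(1,2) by (auto simp: mult.assoc intro!: div_less_mod_less)
    then show "c u * M (B u) $$ (i mod b, j mod b) = c u * ampliation k a b M (\<rho>s u) $$ (i mod (k * b), j mod (k * b))"
      using ij by (simp add: ampliation_def B_def idx')
  qed
  finally show "ampliation (n * k) a b M (cq_state n (k * a) e p \<rho>s) $$ (i, j) =
      mat (n * (k * b)) (n * (k * b)) (\<lambda>(i, j). \<Sum>u<n. complex_of_real (p u) *
      (e u $ (i div (k * b)) * cnj (e u $ (j div (k * b)))) * ampliation k a b M (\<rho>s u) $$ (i mod (k * b), j mod (k * b))) $$ (i, j)"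
    using ij by (simp add: c_def mult.assoc)
qed (simp_all add: ampliation_def mult.assoc)

text \<open>The channel yields an ensemble with the same basis and weights, whose average state is
  by linearity the image of the old one.\<close>

lemma mutual_information_ampliation_cq_state:
  assumes M: "quantum_channel a b M" and ens: "cq_ensemble n (k * a) e p \<rho>s"
  shows "mutual_information n (k * b) (ampliation (n * k) a b M (cq_state n (k * a) e p \<rho>s)) =
    (\<Sum>u<n. ereal (p u) * relative_entropy (ampliation k a b M (\<rho>s u)) (ampliation k a b M (mixture n (k * a) p \<rho>s)))"
proof -
  have e: "orthonormal_basis n e" and carr: "\<And>u. u < n \<Longrightarrow> \<rho>s u \<in> carrier_mat (k * a) (k * a)"
    using ens by (auto simp: cq_ensemble_def density_psd psd_carrier)
  have "cq_ensemble n (k * b) e p (\<lambda>u. ampliation k a b M (\<rho>s u))"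
    using ens density_ampliation[OF M] by (simp add: cq_ensemble_def)
  then show ?thesis
    by (simp add: ampliation_cq_state[OF M e carr] mutual_information_cq_state ampliation_mixture[OF M carr])
qed

section \<open>Equivalence of the conditions\<close>

lemma add_smult_uminus:
  fixes A B :: "complex mat"
  assumes "A \<in> carrier_mat n n" "B \<in> carrier_mat n n"
  shows "A + (- c) \<cdot>\<^sub>m B = A - c \<cdot>\<^sub>m B"
  using assms by (intro eq_matI) auto

lemma inner_app_add_smult:
  assumes "A \<in> carrier_mat n n" "B \<in> carrier_mat n n"
  shows "inner n (app n (A + c \<cdot>\<^sub>m B) v) w = inner n (app n A v) w + c * inner n (app n B v) w"
  using assms by (simp add: app_add app_smult inner_add_left inner_scale_left cong: inner_cong)

lemma mtrace_add_smult:
  assumes "A \<in> carrier_mat n n" "B \<in> carrier_mat n n"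
  shows "mtrace (A + c \<cdot>\<^sub>m B) = mtrace A + c * mtrace B"
  using assms by (simp add: mtrace_def sum.distrib sum_distrib_left)

lemma relative_entropy_density_nonneg:
  "density_operator n \<rho> \<Longrightarrow> density_operator n \<sigma> \<Longrightarrow> 0 \<le> relative_entropy \<rho> \<sigma>"
  by (rule relative_entropy_nonneg[of n]) (simp_all add: density_operator_def)

text \<open>Support inclusion is domination of a positive multiple, which passes through a positive
  linear map. It makes the relative entropies in (iii) finite.\<close>

lemma supp_subset_ampliation:
  assumes M: "quantum_channel a b M" and \<rho>: "psd (k * a) \<rho>" and \<sigma>: "psd (k * a) \<sigma>"
    and supp: "supp \<rho> \<subseteq> supp \<sigma>"
  shows "supp (ampliation k a b M \<rho>) \<subseteq> supp (ampliation k a b M \<sigma>)"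
proof -
  obtain c where c: "0 < c" "psd (k * a) (\<sigma> - complex_of_real c \<cdot>\<^sub>m \<rho>)"
    using psd_diff_of_supp_subset[OF \<rho> \<sigma> supp] .
  have "ampliation k a b M (\<sigma> - complex_of_real c \<cdot>\<^sub>m \<rho>) =
      ampliation k a b M \<sigma> - complex_of_real c \<cdot>\<^sub>m ampliation k a b M \<rho>"
    using ampliation_add_smult[OF M, of \<sigma> k \<rho> "- complex_of_real c"] psd_carrier[OF \<rho>] psd_carrier[OF \<sigma>]
    by (simp add: add_smult_uminus add_smult_uminus[OF ampliation_carrier ampliation_carrier])
  then show ?thesis
    using supp_subset_of_psd_diff[OF psd_ampliation[OF M \<rho>] psd_ampliation[OF M \<sigma>] c(1)] psd_ampliation[OF M c(2)]
    by simp
qed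

lemma relative_entropy_ampliation_finite:
  assumes "quantum_channel a b M" "psd (k * a) \<rho>" "psd (k * a) \<sigma>" "supp \<rho> \<subseteq> supp \<sigma>"
  obtains x where "relative_entropy (ampliation k a b M \<rho>) (ampliation k a b M \<sigma>) = ereal x"
  using supp_subset_ampliation[OF assms] by (simp add: relative_entropy_def)

text \<open>Removing the term of \<open>u\<close> from the average leaves a nonnegative combination
  of the others, so the average dominates \<open>p u\<close> times \<open>\<rho>s u\<close>.\<close>

lemma supp_subset_mixture:
  assumes p: "\<And>u. u < n \<Longrightarrow> 0 \<le> p u" and \<rho>s: "\<And>u. u < n \<Longrightarrow> psd d (\<rho>s u)" and u: "u < n" "0 < p u"
  shows "supp (\<rho>s u) \<subseteq> supp (mixture n d p \<rho>s)"
proof (rule supp_subset_of_psd_diff[OF \<rho>s[OF u(1)] _ u(2)])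
  show mix: "psd d (mixture n d p \<rho>s)"
    using p \<rho>s by (intro psd_mixture) auto
  show "psd d (mixture n d p \<rho>s - complex_of_real (p u) \<cdot>\<^sub>m \<rho>s u)"
    unfolding psd_iff
  proof (intro conjI allI)
    show "mixture n d p \<rho>s - complex_of_real (p u) \<cdot>\<^sub>m \<rho>s u \<in> carrier_mat d d"
      using psd_carrier[OF mix] psd_carrier[OF \<rho>s[OF u(1)]] by auto
    fix v
    let ?q = "\<lambda>w. complex_of_real (p w) * inner d (app d (\<rho>s w) v) v"
    have "inner d (app d (mixture n d p \<rho>s - complex_of_real (p u) \<cdot>\<^sub>m \<rho>s u) v) v = (\<Sum>w<n. ?q w) - ?q u"
      unfolding inner_app_diff_smult[OF psd_carrier[OF mix] psd_carrier[OF \<rho>s[OF u(1)]]]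
      using psd_carrier[OF \<rho>s] by (simp add: inner_app_mixture)
    also have "\<dots> = (\<Sum>w\<in>{..<n} - {u}. ?q w)"
      using u(1) by (simp add: sum_diff1)
    also have "0 \<le> \<dots>"
      using p \<rho>s by (intro sum_nonneg mult_nonneg_nonneg) (auto simp: psd_iff less_eq_complex_def)
    finally show "0 \<le> inner d (app d (mixture n d p \<rho>s - complex_of_real (p u) \<cdot>\<^sub>m \<rho>s u) v) v" .
  qed
qed

text \<open>Turns the equality of the reference marginals among the members into equality with that
  of the average, the form that (iii) asks for.\<close>

lemma ptrace_snd_mixture:
  assumes p: "(\<Sum>u<n. p u) = 1" and u: "u < n"
    and eq: "\<And>w. w < n \<Longrightarrow> ptrace_snd k a (\<rho>s w) = ptrace_snd k a (\<rho>s u)"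
  shows "ptrace_snd k a (mixture n (k * a) p \<rho>s) = ptrace_snd k a (\<rho>s u)"
proof (rule eq_matI)
  fix i j assume "i < dim_row (ptrace_snd k a (\<rho>s u))" "j < dim_col (ptrace_snd k a (\<rho>s u))"
  then have ij: "i < k" "j < k"
    by (auto simp: ptrace_snd_def)
  have "ptrace_snd k a (mixture n (k * a) p \<rho>s) $$ (i, j) =
      (\<Sum>l<a. \<Sum>w<n. complex_of_real (p w) * \<rho>s w $$ (i * a + l, j * a + l))"
    using ij index_in_block by (simp add: ptrace_snd_def mixture_def)
  also have "\<dots> = (\<Sum>w<n. \<Sum>l<a. complex_of_real (p w) * \<rho>s w $$ (i * a + l, j * a + l))"
    by (rule sum.swap)
  also have "\<dots> = (\<Sum>w<n. complex_of_real (p w) * ptrace_snd k a (\<rho>s w) $$ (i, j))"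
    using ij by (simp add: ptrace_snd_def sum_distrib_left)
  also have "\<dots> = (\<Sum>w<n. complex_of_real (p w)) * ptrace_snd k a (\<rho>s u) $$ (i, j)"
    using eq by (simp add: sum_distrib_right)
  finally show "ptrace_snd k a (mixture n (k * a) p \<rho>s) $$ (i, j) = ptrace_snd k a (\<rho>s u) $$ (i, j)"
    using p by (simp flip: of_real_sum)
qed (simp_all add: ptrace_snd_def)

text \<open>(iii) implies (ii): the hypothesis is applied to each member of positive weight and then
  averaged.\<close>

lemma mutual_information_bound_of_relative_entropy_bound:
  assumes N: "quantum_channel a b' N" and M: "quantum_channel a b M" and \<sigma>: "density_operator (k * a) \<sigma>"
    and D: "\<And>\<rho>. density_operator (k * a) \<rho> \<Longrightarrow> supp \<rho> \<subseteq> supp \<sigma> \<Longrightarrow> ptrace_snd k a \<rho> = ptrace_snd k a \<sigma> \<Longrightarrow>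
      relative_entropy (ampliation k a b' N \<rho>) (ampliation k a b' N \<sigma>)
      \<le> ereal \<eta> * relative_entropy (ampliation k a b M \<rho>) (ampliation k a b M \<sigma>)"
    and ens: "cq_ensemble n (k * a) e p \<rho>s"
    and marginal: "ptrace_fst n (k * a) (cq_state n (k * a) e p \<rho>s) = \<sigma>"
    and eq: "\<And>u v. u < n \<Longrightarrow> v < n \<Longrightarrow> ptrace_snd k a (\<rho>s u) = ptrace_snd k a (\<rho>s v)"
  shows "mutual_information n (k * b') (ampliation (n * k) a b' N (cq_state n (k * a) e p \<rho>s))
    \<le> ereal \<eta> * mutual_information n (k * b) (ampliation (n * k) a b M (cq_state n (k * a) e p \<rho>s))"
proof -
  have e: "orthonormal_basis n e" and p: "\<And>u. u < n \<Longrightarrow> 0 \<le> p u" "(\<Sum>u<n. p u) = 1"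
    and dens: "\<And>u. u < n \<Longrightarrow> density_operator (k * a) (\<rho>s u)"
    using ens by (auto simp: cq_ensemble_def prob_dist_def)
  have psd: "psd (k * a) (\<rho>s u)" if "u < n" for u
    using dens[OF that] by (rule density_psd)
  have mix: "mixture n (k * a) p \<rho>s = \<sigma>"
    using ptrace_fst_cq_state[OF e, of \<rho>s "k * a" p] psd_carrier[OF psd] marginal by simp
  let ?D = "\<lambda>b M u. relative_entropy (ampliation k a b M (\<rho>s u)) (ampliation k a b M \<sigma>)"
  \<comment> \<open>Nonnegativity allows \<open>\<eta>\<close> to be pulled out of the sum of
    possibly infinite terms below.\<close>
  have D_nonneg: "0 \<le> ?D b M u" if "u < n" for u
    using density_ampliation[OF M dens[OF that]] density_ampliation[OF M \<sigma>]
    by (rule relative_entropy_density_nonneg)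
  have "mutual_information n (k * b') (ampliation (n * k) a b' N (cq_state n (k * a) e p \<rho>s)) =
      (\<Sum>u<n. ereal (p u) * ?D b' N u)"
    unfolding mutual_information_ampliation_cq_state[OF N ens] mix ..
  also have "\<dots> \<le> (\<Sum>u<n. ereal \<eta> * (ereal (p u) * ?D b M u))"
  proof (intro sum_mono)
    fix u assume "u \<in> {..<n}"
    then have u: "u < n" by simp
    show "ereal (p u) * ?D b' N u \<le> ereal \<eta> * (ereal (p u) * ?D b M u)"
    \<comment> \<open>A member of weight zero may violate the support condition and have infinite
      relative entropy; its terms vanish since zero times infinity is zero.\<close>
    proof (cases "p u = 0")
      case False
      then have "supp (\<rho>s u) \<subseteq> supp \<sigma>"
        using supp_subset_mixture[of n p "k * a" \<rho>s u] p(1) psd u mix by force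
      moreover have "ptrace_snd k a (\<rho>s u) = ptrace_snd k a \<sigma>"
        using ptrace_snd_mixture[OF p(2) u, of k a \<rho>s] eq[OF _ u] mix by simp
      ultimately have "ereal (p u) * ?D b' N u \<le> ereal (p u) * (ereal \<eta> * ?D b M u)"
        using D[OF dens[OF u]] p(1)[OF u] by (intro ereal_mult_left_mono) auto
      then show ?thesis
        by (simp only: mult.left_commute)
    qed (simp add: zero_ereal_def[symmetric])
  qed
  also have "\<dots> = ereal \<eta> * (\<Sum>u<n. ereal (p u) * ?D b M u)"
    using D_nonneg p(1) by (intro sum_ereal_right_distrib[symmetric]) simp
  also have "(\<Sum>u<n. ereal (p u) * ?D b M u) = mutual_information n (k * b) (ampliation (n * k) a b M (cq_state n (k * a) e p \<rho>s))"
    unfolding mutual_information_ampliation_cq_state[OF M ens] mix ..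
  finally show ?thesis .
qed

text \<open>(i) implies (iii): (i) is applied to a one-parameter family of two-member ensembles, and
  the limit of vanishing weight of \<open>\<rho>\<close> isolates its relative entropies.\<close>

lemma relative_entropy_bound_of_mutual_information_bound:
  assumes N: "quantum_channel a b' N" and M: "quantum_channel a b M" and \<sigma>: "density_operator (k * a) \<sigma>" and \<eta>: "0 \<le> \<eta>"
    and I: "\<And>e p \<rho>s. cq_ensemble 2 (k * a) e p \<rho>s \<Longrightarrow>
      ptrace_fst 2 (k * a) (cq_state 2 (k * a) e p \<rho>s) = \<sigma> \<Longrightarrow>
      ptrace_snd k a (\<rho>s 0) = ptrace_snd k a (\<rho>s 1) \<Longrightarrow>
      mutual_information 2 (k * b') (ampliation (2 * k) a b' N (cq_state 2 (k * a) e p \<rho>s))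
      \<le> ereal \<eta> * mutual_information 2 (k * b) (ampliation (2 * k) a b M (cq_state 2 (k * a) e p \<rho>s))"
    and \<rho>: "density_operator (k * a) \<rho>" and supp: "supp \<rho> \<subseteq> supp \<sigma>" and eq: "ptrace_snd k a \<rho> = ptrace_snd k a \<sigma>"
  shows "relative_entropy (ampliation k a b' N \<rho>) (ampliation k a b' N \<sigma>)
    \<le> ereal \<eta> * relative_entropy (ampliation k a b M \<rho>) (ampliation k a b M \<sigma>)"
proof -
  let ?M = "ampliation k a b M" and ?N = "ampliation k a b' N"
  note psd = density_psd[OF \<rho>] density_psd[OF \<sigma>]
  note carr = psd_carrier[OF psd(1)] psd_carrier[OF psd(2)]
  obtain x where x: "relative_entropy (?M \<rho>) (?M \<sigma>) = ereal x"
    using relative_entropy_ampliation_finite[OF M psd supp] .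
  obtain y where y: "relative_entropy (?N \<rho>) (?N \<sigma>) = ereal y"
    using relative_entropy_ampliation_finite[OF N psd supp] .
  \<comment> \<open>\<open>c\<close> limits the size of the perturbation: \<open>\<tau>\<close>
    below is positive for \<open>\<mu> \<le> c\<close>.\<close>
  obtain c where c: "0 < c" "psd (k * a) (\<sigma> - complex_of_real c \<cdot>\<^sub>m \<rho>)"
    using psd_diff_of_supp_subset[OF psd supp] .
  \<comment> \<open>The direction from \<open>\<rho>\<close> to \<open>\<sigma>\<close>. Its trace
    is zero, as the perturbation bound requires.\<close>
  define \<Delta> where "\<Delta> = \<sigma> + (- 1) \<cdot>\<^sub>m \<rho>"
  have \<Delta>: "\<Delta> \<in> carrier_mat (k * a) (k * a)" "mtrace \<Delta> = 0"
    using carr \<rho> \<sigma> by (auto simp: \<Delta>_def mtrace_add_smult density_operator_def)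
  have "mtrace (?M \<Delta>) = 0"
    using \<Delta> by (simp add: mtrace_ampliation[OF M])
  then obtain C where C: "\<And>\<mu> A. 0 < \<mu> \<Longrightarrow> psd (k * b) A \<Longrightarrow> A = ?M \<sigma> + complex_of_real \<mu> \<cdot>\<^sub>m ?M \<Delta> \<Longrightarrow>
      supp A \<subseteq> supp (?M \<sigma>) \<Longrightarrow> relative_entropy A (?M \<sigma>) \<le> ereal (C * \<mu>\<^sup>2)"
    using relative_entropy_perturbation_bound[OF psd_ampliation[OF M psd(2)] ampliation_carrier] by metis
  have bound: "y \<le> \<eta> * x + \<eta> * C * \<mu>" if \<mu>: "0 < \<mu>" "\<mu> \<le> c" for \<mu>
  proof -
    define \<tau> where "\<tau> = \<sigma> + complex_of_real \<mu> \<cdot>\<^sub>m \<Delta>"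
    have \<tau>_carr: "\<tau> \<in> carrier_mat (k * a) (k * a)"
      using carr \<Delta> by (simp add: \<tau>_def)
    have \<tau>_form: "inner (k * a) (app (k * a) \<tau> v) v = (1 + \<mu>) * inner (k * a) (app (k * a) \<sigma> v) v - \<mu> * inner (k * a) (app (k * a) \<rho> v) v" for v
      using carr \<Delta>(1) by (simp add: \<tau>_def \<Delta>_def inner_app_add_smult algebra_simps)
    \<comment> \<open>Since \<open>\<mu> \<le> c\<close>, the form of \<open>\<tau>\<close> is at
      least the form of \<open>\<sigma>\<close> minus \<open>c\<close> times that of
      \<open>\<rho>\<close>, which is nonnegative.\<close>
    have "psd (k * a) \<tau>"
      unfolding psd_iff
    proof (intro conjI allI)
      fix v
      let ?s = "inner (k * a) (app (k * a) \<sigma> v) v" and ?r = "inner (k * a) (app (k * a) \<rho> v) v"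
      have "0 \<le> ?s" "0 \<le> ?r" "0 \<le> ?s - c * ?r"
        using psd c(2) carr by (simp_all add: psd_iff flip: inner_app_diff_smult)
      then have real: "Im ?s = 0" "Im ?r = 0" and ineq: "0 \<le> Re ?s" "0 \<le> Re ?r" "c * Re ?r \<le> Re ?s"
        by (auto simp: less_eq_complex_def)
      have "\<mu> * Re ?r \<le> c * Re ?r" "0 \<le> \<mu> * Re ?s"
        using \<mu> ineq by (auto intro: mult_right_mono)
      then have "0 \<le> (1 + \<mu>) * Re ?s - \<mu> * Re ?r"
        using ineq by (simp add: algebra_simps)
      then show "0 \<le> inner (k * a) (app (k * a) \<tau> v) v"
        unfolding \<tau>_form using real by (simp add: less_eq_complex_def)
    qed (rule \<tau>_carr)
    then have \<tau>: "density_operator (k * a) \<tau>"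
      using carr(2) \<Delta> \<sigma> by (simp add: density_operator_def \<tau>_def mtrace_add_smult)
    \<comment> \<open>The weights for which \<open>\<rho>\<close> and \<open>\<tau>\<close> average
      to \<open>\<sigma>\<close>; that of \<open>\<rho>\<close> is of order
      \<open>\<mu>\<close>.\<close>
    define p where "p u = (if u = 0 then \<mu> / (1 + \<mu>) else 1 / (1 + \<mu>))" for u :: nat
    define \<rho>s where "\<rho>s u = (if u = 0 then \<rho> else \<tau>)" for u :: nat
    have sum2: "(\<Sum>u<2. F u) = F 0 + F 1" for F :: "nat \<Rightarrow> 'z::comm_monoid_add"
      by (simp add: numeral_2_eq_2)
    have e: "orthonormal_basis 2 (unit_vec 2)"
      by (auto simp: orthonormal_basis_def)
    have ens: "cq_ensemble 2 (k * a) (unit_vec 2) p \<rho>s"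
      using e \<rho> \<tau> \<mu> by (auto simp: cq_ensemble_def prob_dist_def sum2 p_def \<rho>s_def field_simps)
    have mix: "mixture 2 (k * a) p \<rho>s = \<sigma>"
    proof (rule eq_matI)
      fix i j assume "i < dim_row \<sigma>" "j < dim_col \<sigma>"
      moreover have "complex_of_real (\<mu> / (1 + \<mu>)) * z + complex_of_real (1 / (1 + \<mu>)) * (w + complex_of_real \<mu> * (w - z)) = w" for z w
      proof -
        have "1 + complex_of_real \<mu> \<noteq> 0"
          using \<mu> by (simp add: complex_eq_iff)
        then show ?thesis
          by (simp add: divide_simps) (simp add: algebra_simps)
      qed
      ultimately show "mixture 2 (k * a) p \<rho>s $$ (i, j) = \<sigma> $$ (i, j)"
        using carr by (simp add: mixture_def sum2 p_def \<rho>s_def \<tau>_def \<Delta>_def)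
    qed (use carr in \<open>simp_all add: mixture_def\<close>)
    have \<rho>s_carr: "\<rho>s u \<in> carrier_mat (k * a) (k * a)" for u
      using carr \<tau>_carr by (simp add: \<rho>s_def)
    \<comment> \<open>\<open>\<rho>\<close> and \<open>\<sigma>\<close> have the same reference
      marginal, so moving along \<open>\<Delta>\<close> does not change it.\<close>
    have "ptrace_snd k a \<tau> = ptrace_snd k a \<rho>"
    proof (rule eq_matI)
      fix i j assume "i < dim_row (ptrace_snd k a \<rho>)" "j < dim_col (ptrace_snd k a \<rho>)"
      then have ij: "i < k" "j < k"
        by (auto simp: ptrace_snd_def)
      have "(\<Sum>l<a. \<sigma> $$ (i * a + l, j * a + l)) = (\<Sum>l<a. \<rho> $$ (i * a + l, j * a + l))"
        using arg_cong[OF eq, of "\<lambda>X. X $$ (i, j)"] ij by (simp add: ptrace_snd_def)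
      then show "ptrace_snd k a \<tau> $$ (i, j) = ptrace_snd k a \<rho> $$ (i, j)"
        using ij index_in_block carr
        by (simp add: ptrace_snd_def \<tau>_def \<Delta>_def sum.distrib sum_subtractf flip: sum_distrib_left)
    qed (simp_all add: ptrace_snd_def)
    then have "ptrace_snd k a (\<rho>s 0) = ptrace_snd k a (\<rho>s 1)"
      by (simp add: \<rho>s_def)
    moreover have "ptrace_fst 2 (k * a) (cq_state 2 (k * a) (unit_vec 2) p \<rho>s) = \<sigma>"
      using ptrace_fst_cq_state[OF e, of \<rho>s "k * a" p] \<rho>s_carr mix by simp
    ultimately have "(\<Sum>u<2. ereal (p u) * relative_entropy (?N (\<rho>s u)) (?N \<sigma>)) \<le>
        ereal \<eta> * (\<Sum>u<2. ereal (p u) * relative_entropy (?M (\<rho>s u)) (?M \<sigma>))"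
      using I[OF ens] unfolding mutual_information_ampliation_cq_state[OF M ens]
        mutual_information_ampliation_cq_state[OF N ens] mix by simp
    then have main: "ereal (\<mu> / (1 + \<mu>)) * ereal y + ereal (1 / (1 + \<mu>)) * relative_entropy (?N \<tau>) (?N \<sigma>) \<le>
        ereal \<eta> * (ereal (\<mu> / (1 + \<mu>)) * ereal x + ereal (1 / (1 + \<mu>)) * relative_entropy (?M \<tau>) (?M \<sigma>))"
      by (simp add: sum2 p_def \<rho>s_def x y)
    have supp_\<tau>: "supp \<tau> \<subseteq> supp \<sigma>"
      using supp_subset_mixture[of 2 p "k * a" \<rho>s 1] \<mu> psd density_psd[OF \<tau>] mix
      by (simp add: p_def \<rho>s_def)
    obtain x' where x': "relative_entropy (?M \<tau>) (?M \<sigma>) = ereal x'"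
      using relative_entropy_ampliation_finite[OF M density_psd[OF \<tau>] psd(2) supp_\<tau>] .
    obtain y' where y': "relative_entropy (?N \<tau>) (?N \<sigma>) = ereal y'"
      using relative_entropy_ampliation_finite[OF N density_psd[OF \<tau>] psd(2) supp_\<tau>] .
    \<comment> \<open>On the \<open>N\<close> side the contribution of \<open>\<tau>\<close> is
      bounded below by zero, on the \<open>M\<close> side above by
      \<open>C * \<mu>\<^sup>2\<close>.\<close>
    have "0 \<le> relative_entropy (?N \<tau>) (?N \<sigma>)"
      using density_ampliation[OF N \<tau>] density_ampliation[OF N \<sigma>]
      by (rule relative_entropy_density_nonneg)
    then have "0 \<le> y'"
      unfolding y' by simp
    have "?M \<tau> = ?M \<sigma> + complex_of_real \<mu> \<cdot>\<^sub>m ?M \<Delta>"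
      unfolding \<tau>_def by (rule ampliation_add_smult[OF M carr(2) \<Delta>(1)])
    then have "x' \<le> C * \<mu>\<^sup>2"
      using C[OF \<mu>(1) psd_ampliation[OF M density_psd[OF \<tau>]]] x'
        supp_subset_ampliation[OF M density_psd[OF \<tau>] psd(2) supp_\<tau>] by simp
    have "(\<mu> * y + y') / (1 + \<mu>) \<le> \<eta> * (\<mu> * x + x') / (1 + \<mu>)"
      using main unfolding x' y' by (simp add: add_divide_distrib distrib_left)
    then have "\<mu> * y + y' \<le> \<eta> * (\<mu> * x + x')"
      using \<mu> by (simp add: divide_le_cancel)
    also have "\<dots> \<le> \<eta> * (\<mu> * x + C * \<mu>\<^sup>2)"
      using \<open>x' \<le> C * \<mu>\<^sup>2\<close> \<eta> by (intro mult_left_mono) auto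
    finally have "\<mu> * y \<le> \<mu> * (\<eta> * x + \<eta> * C * \<mu>)"
      using \<open>0 \<le> y'\<close> by (simp add: algebra_simps power2_eq_square)
    then show ?thesis
      using \<mu> by simp
  qed
  \<comment> \<open>\<open>C\<close> does not depend on \<open>\<mu>\<close>, so the error term in
    \<open>bound\<close> tends to zero.\<close>
  have "y \<le> \<eta> * x"
  proof (rule tendsto_lowerbound[where F = "at_right 0"])
    show "((\<lambda>\<mu>. \<eta> * x + \<eta> * C * \<mu>) \<longlongrightarrow> \<eta> * x) (at_right 0)"
      by (auto intro!: tendsto_eq_intros)
    show "\<forall>\<^sub>F \<mu> in at_right 0. y \<le> \<eta> * x + \<eta> * C * \<mu>"
      using bound c(1) by (intro eventually_at_rightI[of 0 c]) auto
  qed simp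
  then show ?thesis
    by (simp add: x y)
qed

theorem mainTheorem3:
  fixes dR dA dB dB' :: nat
    and M N :: "complex mat \<Rightarrow> complex mat"
    and \<sigma> :: "complex mat"
    and \<eta> :: real
  assumes N: "quantum_channel dA dB' N"
    and M: "quantum_channel dA dB M"
    and \<sigma>: "density_operator (dR * dA) \<sigma>"
    and \<eta>: "0 \<le> \<eta>"
  defines "cond_i \<equiv>
      \<forall>e p \<rho>s. cq_ensemble 2 (dR * dA) e p \<rho>s \<longrightarrow>
        ptrace_fst 2 (dR * dA) (cq_state 2 (dR * dA) e p \<rho>s) = \<sigma> \<longrightarrow>
        ptrace_snd dR dA (\<rho>s 0) = ptrace_snd dR dA (\<rho>s 1) \<longrightarrow>
        ereal \<eta> * mutual_information 2 (dR * dB)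
            (ampliation (2 * dR) dA dB M (cq_state 2 (dR * dA) e p \<rho>s))
          \<ge> mutual_information 2 (dR * dB')
            (ampliation (2 * dR) dA dB' N (cq_state 2 (dR * dA) e p \<rho>s))"
    and "cond_ii \<equiv>
      \<forall>n e p \<rho>s. cq_ensemble n (dR * dA) e p \<rho>s \<longrightarrow>
        ptrace_fst n (dR * dA) (cq_state n (dR * dA) e p \<rho>s) = \<sigma> \<longrightarrow>
        (\<forall>u<n. \<forall>v<n. ptrace_snd dR dA (\<rho>s u) = ptrace_snd dR dA (\<rho>s v)) \<longrightarrow>
        ereal \<eta> * mutual_information n (dR * dB)
            (ampliation (n * dR) dA dB M (cq_state n (dR * dA) e p \<rho>s))
          \<ge> mutual_information n (dR * dB')
            (ampliation (n * dR) dA dB' N (cq_state n (dR * dA) e p \<rho>s))"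
    and "cond_iii \<equiv>
      \<forall>\<rho>. density_operator (dR * dA) \<rho> \<longrightarrow>
        supp \<rho> \<subseteq> supp \<sigma> \<longrightarrow>
        ptrace_snd dR dA \<rho> = ptrace_snd dR dA \<sigma> \<longrightarrow>
        ereal \<eta> * relative_entropy (ampliation dR dA dB M \<rho>) (ampliation dR dA dB M \<sigma>)
          \<ge> relative_entropy (ampliation dR dA dB' N \<rho>) (ampliation dR dA dB' N \<sigma>)"
  shows "(cond_i \<longleftrightarrow> cond_ii) \<and> (cond_ii \<longleftrightarrow> cond_iii)"
proof -
  \<comment> \<open>The cycle (ii), (i), (iii), (ii); its first step is the case
    \<open>n = 2\<close>.\<close>
  have "cond_i" if "cond_ii"
    unfolding cond_i_def
  proof (intro allI impI)
    fix e p \<rho>s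
    assume "cq_ensemble 2 (dR * dA) e p \<rho>s"
      "ptrace_fst 2 (dR * dA) (cq_state 2 (dR * dA) e p \<rho>s) = \<sigma>"
      "ptrace_snd dR dA (\<rho>s 0) = ptrace_snd dR dA (\<rho>s 1)"
    moreover from this(3) have "\<forall>u<2. \<forall>v<2. ptrace_snd dR dA (\<rho>s u) = ptrace_snd dR dA (\<rho>s v)"
      by (auto simp: less_2_cases_iff)
    ultimately show "ereal \<eta> * mutual_information 2 (dR * dB)
            (ampliation (2 * dR) dA dB M (cq_state 2 (dR * dA) e p \<rho>s))
          \<ge> mutual_information 2 (dR * dB')
            (ampliation (2 * dR) dA dB' N (cq_state 2 (dR * dA) e p \<rho>s))"
      using that unfolding cond_ii_def by blast
  qed
  moreover have "cond_iii" if "cond_i"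
    unfolding cond_iii_def
    using relative_entropy_bound_of_mutual_information_bound[OF N M \<sigma> \<eta>] that[unfolded cond_i_def] by blast
  moreover have "cond_ii" if "cond_iii"
    unfolding cond_ii_def
    using mutual_information_bound_of_relative_entropy_bound[OF N M \<sigma>, of \<eta>]
      that[unfolded cond_iii_def] by blast
  ultimately show ?thesis
    by blast
qed

end
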